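(* Let $G$ be an edge-optimal minimally $2$-edge-connected graph of order $n\geq 5$. Then $G$ is bipartite with partite sets the set of vertices of degree $2$ and the set of vertices of degree exceeding $2$.
   Context: Graphs are finite and may have multiple edges but no loops; the degree of a vertex counts edges with multiplicity, and the order of a graph is its number of vertices. For distinct vertices $u,v$ of a graph $G$, $\lambda_G(u,v)$ denotes the maximum number of edge-disjoint $u$--$v$ paths in $G$. The average edge-connectivity of a graph $G$ of order $n$ is $\overline{\lambda}(G)=\sum_{\{u,v\}\subseteq V(G)}\lambda_G(u,v)/\binom{n}{2}$. The edge-connectivity $\lambda(G)$ of a non-trivial graph $G$ is the smallest number of edges whose removal disconnects $G$. A graph $G$ is minimally $2$-edge-connected if $\lambda(G)=2$ and $\lambda(G-e)<2$ for every edge $e$ of $G$. A minimally $2$-edge-connected graph of order $n$ is called edge-optimal if it has maximum average edge-connectivity among all minimally $2$-edge-connected graphs of order $n$. *)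

theory Defs
  imports Complex_Main
begin

text \<open>
  Multigraphs have edges with an identity of their own, so that parallel edges are distinct edges
  with the same set of ends.
\<close>

record ('v, 'e) mgraph =
  vertices :: "'v set"
  edges :: "'e set"
  ends :: "'e \<Rightarrow> 'v set"

locale multigraph =
  fixes G :: "('v, 'e) mgraph"
  assumes finite_vertices: "finite (vertices G)"
    and finite_edges: "finite (edges G)"
    and ends_subset: "e \<in> edges G \<Longrightarrow> ends G e \<subseteq> vertices G"
    and card_ends: "e \<in> edges G \<Longrightarrow> card (ends G e) = 2"

definition order :: "('v, 'e) mgraph \<Rightarrow> nat" where
  "order G = card (vertices G)"

definition degree :: "('v, 'e) mgraph \<Rightarrow> 'v \<Rightarrow> nat" where
  "degree G v = card {e \<in> edges G. v \<in> ends G e}"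

definition del_edges :: "('v, 'e) mgraph \<Rightarrow> 'e set \<Rightarrow> ('v, 'e) mgraph" where
  "del_edges G F = G\<lparr>edges := edges G - F\<rparr>"

text \<open>A path is given by its sequence of vertices and its sequence of edges.\<close>

definition is_path :: "('v, 'e) mgraph \<Rightarrow> 'v list \<times> 'e list \<Rightarrow> bool" where
  "is_path G = (\<lambda>(vs, es).
     length vs = Suc (length es) \<and> distinct vs \<and> set vs \<subseteq> vertices G \<and>
     (\<forall>i < length es. es ! i \<in> edges G \<and> ends G (es ! i) = {vs ! i, vs ! Suc i}))"

text \<open>
  The direction of a path is irrelevant, so its end vertices are an unordered pair.  A path and its
  reversal are distinct as lists, but they are never edge-disjoint unless they are trivial.
\<close>

definition path_between :: "('v, 'e) mgraph \<Rightarrow> 'v \<Rightarrow> 'v \<Rightarrow> 'v list \<times> 'e list \<Rightarrow> bool" where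
  "path_between G u v p \<longleftrightarrow> is_path G p \<and> {hd (fst p), last (fst p)} = {u, v}"

definition edge_disjoint :: "('v list \<times> 'e list) set \<Rightarrow> bool" where
  "edge_disjoint P \<longleftrightarrow> (\<forall>p \<in> P. \<forall>q \<in> P. p \<noteq> q \<longrightarrow> set (snd p) \<inter> set (snd q) = {})"

definition local_edge_conn :: "('v, 'e) mgraph \<Rightarrow> 'v \<Rightarrow> 'v \<Rightarrow> nat" where
  "local_edge_conn G u v =
     Max {card P | P. finite P \<and> (\<forall>p \<in> P. path_between G u v p) \<and> edge_disjoint P}"

lemma local_edge_conn_commute: "local_edge_conn G u v = local_edge_conn G v u"
  by (simp add: local_edge_conn_def path_between_def insert_commute)

text \<open>
  The local edge-connectivity is symmetric, hence a function of the unordered pair of vertices.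
\<close>

definition pair_edge_conn :: "('v, 'e) mgraph \<Rightarrow> 'v set \<Rightarrow> nat" where
  "pair_edge_conn G S = (THE k. \<exists>u v. S = {u, v} \<and> k = local_edge_conn G u v)"

lemma pair_edge_conn_eq: "pair_edge_conn G {u, v} = local_edge_conn G u v"
  unfolding pair_edge_conn_def
proof (rule the_equality)
  show "\<exists>x y. {u, v} = {x, y} \<and> local_edge_conn G u v = local_edge_conn G x y"
    by blast
next
  fix k
  assume "\<exists>x y. {u, v} = {x, y} \<and> k = local_edge_conn G x y"
  then show "k = local_edge_conn G u v"
    by (auto simp: doubleton_eq_iff local_edge_conn_commute)
qed

definition avg_edge_conn :: "('v, 'e) mgraph \<Rightarrow> real" where
  "avg_edge_conn G =
     (\<Sum>S | S \<subseteq> vertices G \<and> card S = 2. real (pair_edge_conn G S)) / real (order G choose 2)"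

definition connected_graph :: "('v, 'e) mgraph \<Rightarrow> bool" where
  "connected_graph G \<longleftrightarrow>
     vertices G \<noteq> {} \<and> (\<forall>u \<in> vertices G. \<forall>v \<in> vertices G. \<exists>p. path_between G u v p)"

text \<open>Only meaningful for graphs with at least two vertices.\<close>

definition edge_conn :: "('v, 'e) mgraph \<Rightarrow> nat" where
  "edge_conn G =
     (LEAST k. \<exists>F. F \<subseteq> edges G \<and> card F = k \<and> \<not> connected_graph (del_edges G F))"

definition minimally_2_edge_connected :: "('v, 'e) mgraph \<Rightarrow> bool" where
  "minimally_2_edge_connected G \<longleftrightarrow>
     order G \<ge> 2 \<and> edge_conn G = 2 \<and> (\<forall>e \<in> edges G. edge_conn (del_edges G {e}) < 2)"

text \<open>
  Every multigraph is finite, hence isomorphic to one whose vertices and edges are natural numbers.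
  The competitors range over the latter because one cannot quantify over types.
\<close>

definition edge_optimal :: "('v, 'e) mgraph \<Rightarrow> bool" where
  "edge_optimal G \<longleftrightarrow>
     minimally_2_edge_connected G \<and>
     (\<forall>H :: (nat, nat) mgraph.
        multigraph H \<and> minimally_2_edge_connected H \<and> order H = order G \<longrightarrow>
        avg_edge_conn H \<le> avg_edge_conn G)"

definition bipartite_with :: "('v, 'e) mgraph \<Rightarrow> 'v set \<Rightarrow> 'v set \<Rightarrow> bool" where
  "bipartite_with G A B \<longleftrightarrow>
     A \<union> B = vertices G \<and> A \<inter> B = {} \<and>
     (\<forall>e \<in> edges G. \<exists>a \<in> A. \<exists>b \<in> B. ends G e = {a, b})"

end

theory Submission
  imports Defs
begin

text \<open>
  By Menger's theorem, the connectivity of two vertices is the size of a smallest cut that separates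
  them. Hence a graph is minimally 2-edge-connected iff every cut has at least two edges and every
  edge lies in a cut with exactly two edges. Call a vertex lonely if it has connectivity 2 to every
  other vertex. Contracting an edge \<open>uv\<close> and subdividing another edge of a 2-cut that
  contains it preserves minimality and does not decrease the total connectivity; if neither
  \<open>u\<close> nor \<open>v\<close> is lonely, then two classes of highly connected vertices are
  merged and the total increases. So in an optimal graph every edge has a lonely end. If
  \<open>u\<close> is lonely, contracting \<open>uv\<close> loses no more than any new vertex of
  degree 2 brings back. So if the contracted graph is minimally 2-edge-connected, the total
  increases when a new vertex is joined to two vertices of connectivity at least 3, which exist
  since \<open>K\<^bsub>2,n-2\<^esub>\<close> beats every graph without such a pair. This excludes
  edges with two lonely ends and edges that form 2-cuts with two different edges. Finally, at a
  lonely vertex of degree at least 3 the first operation would produce an optimal graph that has an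
  edge without a lonely end.
\<close>

subsection \<open>Menger's theorem\<close>

text \<open>\<open>S\<close> ranges over all sets of the vertex type, so that complements, symmetric
  differences and preimages are again admissible. By \<open>mem_cut\<close>, an edge crosses iff
  exactly one of its ends lies in \<open>S\<close>.\<close>

definition cut :: "('v, 'e) mgraph \<Rightarrow> 'v set \<Rightarrow> 'e set" where
  "cut G S = {e \<in> edges G. ends G e \<inter> S \<noteq> {} \<and> \<not> ends G e \<subseteq> S}"

lemma cut_subset: "cut G S \<subseteq> edges G"
  by (auto simp: cut_def)

lemma cut_edge: "e \<in> cut G S \<Longrightarrow> e \<in> edges G"
  by (simp add: cut_def)

lemma cut_Compl: "cut G (- S) = cut G S"
  by (auto simp: cut_def)

lemma mem_cut: "ends G e = {a, b} \<Longrightarrow> e \<in> cut G S \<longleftrightarrow> e \<in> edges G \<and> (a \<in> S) \<noteq> (b \<in> S)"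
  by (auto simp: cut_def)

context multigraph
begin

lemma ends_cases:
  assumes "e \<in> edges G"
  obtains a b where "ends G e = {a, b}" "a \<noteq> b" "a \<in> vertices G" "b \<in> vertices G"
proof -
  obtain a b where "ends G e = {a, b}" "a \<noteq> b"
    using card_ends[OF assms] by (auto simp: card_2_iff)
  with ends_subset[OF assms] show ?thesis by (auto intro: that)
qed

lemma finite_cut: "finite (cut G S)"
  using finite_edges cut_subset by (rule finite_subset[rotated])

lemma cut_Int_vertices: "cut G (S \<inter> vertices G) = cut G S"
proof -
  have "e \<in> cut G (S \<inter> vertices G) \<longleftrightarrow> e \<in> cut G S" if "e \<in> edges G" for e
    using that by (rule ends_cases) (auto simp: mem_cut)
  then show ?thesis using cut_subset[of G] by blast
qed

lemma cut_singleton: "cut G {v} = {e \<in> edges G. v \<in> ends G e}"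
proof -
  have "e \<in> cut G {v} \<longleftrightarrow> e \<in> edges G \<and> v \<in> ends G e" if e: "e \<in> edges G" for e
    using e by (rule ends_cases) (auto simp: mem_cut e)
  then show ?thesis using cut_subset[of G] by blast
qed

text \<open>Taking cuts is linear over GF(2). This is the source of all later recombinations of
  2-cuts.\<close>

lemma cut_sym_diff: "cut G (sym_diff S T) = sym_diff (cut G S) (cut G T)"
proof -
  have "e \<in> cut G (sym_diff S T) \<longleftrightarrow> e \<in> sym_diff (cut G S) (cut G T)" if "e \<in> edges G" for e
    using that by (rule ends_cases) (auto simp: mem_cut)
  then show ?thesis using cut_subset[of G] by blast
qed

section \<open>Paths and reachability\<close>

lemma is_path_take:
  assumes "is_path G (vs, es)" "j < length vs"
  shows "is_path G (take (Suc j) vs, take j es)"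
  using assms set_take_subset[of "Suc j" vs] by (auto simp: is_path_def)

lemma is_path_snoc:
  assumes "is_path G (vs, es)" "e \<in> edges G" "ends G e = {last vs, b}" "b \<notin> set vs"
  shows "is_path G (vs @ [b], es @ [e])"
proof -
  have "b \<in> vertices G" using ends_subset[OF assms(2)] assms(3) by auto
  moreover have "vs \<noteq> []" using assms(1) by (auto simp: is_path_def)
  ultimately show ?thesis
    using assms by (auto simp: is_path_def nth_append last_conv_nth less_Suc_eq)
qed

text \<open>\<open>R\<close> collects the vertices reachable from \<open>s\<close> by steps that
  satisfy \<open>A\<close>. The relation \<open>A\<close> is left open: it will express residual
  capacity, positive flow, or no restriction at all.\<close>

lemma path_or_closed:
  assumes s: "s \<in> vertices G"
  shows "(\<exists>vs es. is_path G (vs, es) \<and> hd vs = s \<and> last vs = t \<and>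
            (\<forall>i < length es. A (vs ! i) (es ! i) (vs ! Suc i))) \<or>
         (\<exists>R. s \<in> R \<and> t \<notin> R \<and>
            (\<forall>e \<in> edges G. \<forall>a \<in> R. \<forall>b. b \<notin> R \<and> ends G e = {a, b} \<longrightarrow> \<not> A a e b))"
    (is "(\<exists>vs es. ?P vs es t) \<or> _")
proof (cases "\<exists>vs es. ?P vs es t")
  case False
  define R where "R = {v. \<exists>vs es. ?P vs es v}"
  have "?P [s] [] s" using s by (auto simp: is_path_def)
  then have "s \<in> R" unfolding R_def by (intro CollectI exI)
  moreover have "t \<notin> R" using False by (simp add: R_def)
  moreover have "b \<in> R"
    if e: "e \<in> edges G" and a: "a \<in> R" and ends: "ends G e = {a, b}" and A: "A a e b" for e a b
  proof -
    obtain vs es where p: "is_path G (vs, es)" and hd: "hd vs = s" and last: "last vs = a"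
        and al: "\<forall>i < length es. A (vs ! i) (es ! i) (vs ! Suc i)"
      using a unfolding R_def by (elim CollectE exE conjE)
    have len: "length vs = Suc (length es)" and ne: "vs \<noteq> []" using p by (auto simp: is_path_def)
    show ?thesis
    proof (cases "b \<in> set vs")
      case True
      \<comment> \<open>A step back to a vertex of the path is handled by cutting the path off
        there, which keeps its vertices distinct.\<close>
      then obtain j where j: "j < length vs" "vs ! j = b" by (auto simp: in_set_conv_nth)
      have "is_path G (take (Suc j) vs, take j es)" using p j(1) by (rule is_path_take)
      moreover have "hd (take (Suc j) vs) = s" using hd by simp
      moreover have "last (take (Suc j) vs) = b" by (simp only: take_Suc_conv_app_nth[OF j(1)] last_snoc j(2))
      moreover have "\<forall>i < length (take j es). A (take (Suc j) vs ! i) (take j es ! i)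
          (take (Suc j) vs ! Suc i)"
        using al by simp
      ultimately show ?thesis unfolding R_def by (intro CollectI exI conjI)
    next
      case False
      have "is_path G (vs @ [b], es @ [e])" using p e ends False unfolding last[symmetric]
        by (rule is_path_snoc)
      moreover have "hd (vs @ [b]) = s" "last (vs @ [b]) = b" using hd ne by simp_all
      moreover have "\<forall>i < length (es @ [e]). A ((vs @ [b]) ! i) ((es @ [e]) ! i)
          ((vs @ [b]) ! Suc i)"
        using al len last ne A by (auto simp: nth_append less_Suc_eq last_conv_nth)
      ultimately show ?thesis unfolding R_def by (intro CollectI exI conjI)
    qed
  qed
  ultimately have "s \<in> R \<and> t \<notin> R \<and>
      (\<forall>e \<in> edges G. \<forall>a \<in> R. \<forall>b. b \<notin> R \<and> ends G e = {a, b} \<longrightarrow> \<not> A a e b)"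
    by blast
  then show ?thesis by (intro disjI2 exI)
qed simp

lemma path_crosses_cut:
  assumes p: "is_path G (vs, es)" and sep: "(hd vs \<in> S) \<noteq> (last vs \<in> S)"
  shows "set es \<inter> cut G S \<noteq> {}"
proof (rule ccontr)
  assume *: "\<not> ?thesis"
  have len: "length vs = Suc (length es)" using p by (auto simp: is_path_def)
  have step: "(vs ! i \<in> S) = (vs ! Suc i \<in> S)" if "i < length es" for i
  proof -
    have "es ! i \<notin> cut G S" using * that nth_mem by blast
    then show ?thesis using p that by (auto simp: is_path_def cut_def)
  qed
  have "(vs ! i \<in> S) = (vs ! 0 \<in> S)" if "i \<le> length es" for i
    using that by (induction i) (auto simp: step[symmetric])
  moreover have "hd vs = vs ! 0" "last vs = vs ! length es"
    using len by (simp_all add: hd_conv_nth last_conv_nth flip: length_greater_0_conv)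
  ultimately show False using sep by (metis order_refl)
qed

text \<open>Steps at different positions join different pairs of vertices, while an edge has only
  one pair of ends.\<close>

lemma path_edges_distinct:
  assumes p: "is_path G (vs, es)"
  shows "distinct es"
  unfolding distinct_conv_nth
proof (intro allI impI notI)
  fix i j assume ij: "i < length es" "j < length es" "i \<noteq> j" and eq: "es ! i = es ! j"
  have inj: "vs ! k = vs ! l \<longleftrightarrow> k = l" if "k \<le> length es" "l \<le> length es" for k l
    using p that by (simp add: is_path_def nth_eq_iff_index_eq)
  have "{vs ! i, vs ! Suc i} = {vs ! j, vs ! Suc j}"
  proof -
    have "ends G (es ! i) = {vs ! i, vs ! Suc i}" "ends G (es ! j) = {vs ! j, vs ! Suc j}"
      using p ij by (simp_all add: is_path_def)
    then show ?thesis using eq by simp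
  qed
  then show False
    using ij by (auto simp: doubleton_eq_iff inj)
qed

end

section \<open>Unit flows\<close>

text \<open>\<open>\<phi> e v\<close> is the amount of flow that the edge \<open>e\<close> carries away from its end \<open>v\<close>.\<close>

definition unit_flow :: "('v, 'e) mgraph \<Rightarrow> 'v \<Rightarrow> 'v \<Rightarrow> nat \<Rightarrow> ('e \<Rightarrow> 'v \<Rightarrow> int) \<Rightarrow> bool" where
  "unit_flow G s t k \<phi> \<longleftrightarrow>
     (\<forall>e \<in> edges G. \<forall>a b. ends G e = {a, b} \<longrightarrow> \<phi> e a = - \<phi> e b \<and> \<bar>\<phi> e a\<bar> \<le> 1) \<and>
     (\<forall>e \<in> edges G. \<forall>v. v \<notin> ends G e \<longrightarrow> \<phi> e v = 0) \<and>
     (\<forall>v \<in> vertices G. (\<Sum>e \<in> edges G. \<phi> e v) = int k * (of_bool (v = s) - of_bool (v = t)))"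

text \<open>One unit of flow along the path: each edge carries 1 away from its first end and -1 away
  from its second one.\<close>

definition path_flow :: "'v list \<Rightarrow> 'e list \<Rightarrow> 'e \<Rightarrow> 'v \<Rightarrow> int" where
  "path_flow vs es e v =
     (\<Sum>i < length es. of_bool (e = es ! i) * (of_bool (v = vs ! i) - of_bool (v = vs ! Suc i)))"

context multigraph
begin

lemma path_flow_nth:
  assumes "is_path G (vs, es)" "i < length es"
  shows "path_flow vs es (es ! i) v = of_bool (v = vs ! i) - of_bool (v = vs ! Suc i)"
proof -
  have "path_flow vs es (es ! i) v =
      (\<Sum>j < length es. if j = i then of_bool (v = vs ! i) - of_bool (v = vs ! Suc i) else 0)"
    unfolding path_flow_def using assms path_edges_distinct[OF assms(1)]
    by (intro sum.cong) (auto simp: nth_eq_iff_index_eq)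
  then show ?thesis using assms by simp
qed

lemma path_flow_outside: "e \<notin> set es \<Longrightarrow> path_flow vs es e v = 0"
  unfolding path_flow_def by (intro sum.neutral) auto

lemma path_flow_net:
  assumes p: "is_path G (vs, es)"
  shows "(\<Sum>e \<in> edges G. path_flow vs es e v) = of_bool (v = hd vs) - of_bool (v = last vs)"
proof -
  have es: "es ! i \<in> edges G" if "i < length es" for i using p that by (auto simp: is_path_def)
  have len: "length vs = Suc (length es)" and ne: "vs \<noteq> []" using p by (auto simp: is_path_def)
  have "(\<Sum>e \<in> edges G. path_flow vs es e v) =
      (\<Sum>i < length es. \<Sum>e \<in> edges G.
         if e = es ! i then of_bool (v = vs ! i) - of_bool (v = vs ! Suc i) else 0)"
    unfolding path_flow_def by (subst sum.swap) (intro sum.cong, auto)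
  also have "\<dots> = (\<Sum>i < length es. of_bool (v = vs ! i) - of_bool (v = vs ! Suc i))"
    using finite_edges es by (intro sum.cong) auto
  also have "\<dots> = of_bool (v = vs ! 0) - of_bool (v = vs ! length es)"
    by (rule sum_lessThan_telescope')
  finally show ?thesis using len ne by (simp add: hd_conv_nth last_conv_nth)
qed

lemma path_flow_ends:
  assumes p: "is_path G (vs, es)" and e: "e \<in> edges G"
  shows "ends G e = {a, b} \<Longrightarrow> path_flow vs es e a = - path_flow vs es e b"
    and "v \<notin> ends G e \<Longrightarrow> path_flow vs es e v = 0"
proof -
  show "path_flow vs es e a = - path_flow vs es e b" if ab: "ends G e = {a, b}"
  proof (cases "e \<in> set es")
    case True
    then obtain i where i: "i < length es" "e = es ! i" by (auto simp: in_set_conv_nth)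
    then have "{a, b} = {vs ! i, vs ! Suc i}" "vs ! i \<noteq> vs ! Suc i"
      using p ab by (auto simp: is_path_def nth_eq_iff_index_eq)
    then show ?thesis using i path_flow_nth[OF p i(1)] by (auto simp: doubleton_eq_iff)
  qed (simp add: path_flow_outside)
  show "path_flow vs es e v = 0" if v: "v \<notin> ends G e"
  proof (cases "e \<in> set es")
    case True
    then obtain i where i: "i < length es" "e = es ! i" by (auto simp: in_set_conv_nth)
    then have "ends G e = {vs ! i, vs ! Suc i}" using p by (auto simp: is_path_def)
    then show ?thesis using i v path_flow_nth[OF p i(1)] by auto
  qed (simp add: path_flow_outside)
qed

lemma unit_flow_bound:
  assumes "unit_flow G s t k \<phi>" "e \<in> edges G" "ends G e = {a, b}"
  shows "\<bar>\<phi> e a\<bar> \<le> 1"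
  using assms unfolding unit_flow_def by blast

text \<open>Summed over the vertices of \<open>R\<close>, the flow on an edge inside
  \<open>R\<close> cancels, so the value \<open>k\<close> is the flow out of \<open>R\<close>. The
  upper bound serves the decomposition, the lower bound the augmentation.\<close>

lemma flow_across_cut:
  assumes fl: "unit_flow G s t k \<phi>" and R: "s \<in> R" "t \<notin> R" "s \<in> vertices G"
    and c: "\<And>e a b. e \<in> edges G \<Longrightarrow> ends G e = {a, b} \<Longrightarrow> a \<in> R \<Longrightarrow> b \<notin> R \<Longrightarrow> \<phi> e a \<le> c"
    and c': "\<And>e a b. e \<in> edges G \<Longrightarrow> ends G e = {a, b} \<Longrightarrow> a \<in> R \<Longrightarrow> b \<notin> R \<Longrightarrow> c' \<le> \<phi> e a"
  shows "int k \<le> c * int (card (cut G R))" "c' * int (card (cut G R)) \<le> int k"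
proof -
  let ?RV = "vertices G \<inter> R"
  define net where "net e = (\<Sum>v \<in> ?RV. \<phi> e v)" for e
  have fin: "finite ?RV" using finite_vertices by simp
  have net: "(e \<in> cut G R \<longrightarrow> c' \<le> net e \<and> net e \<le> c) \<and> (e \<notin> cut G R \<longrightarrow> net e = 0)"
    if e: "e \<in> edges G" for e
  proof -
    obtain a b where ab: "ends G e = {a, b}" "a \<noteq> b" "a \<in> vertices G" "b \<in> vertices G"
      using e by (rule ends_cases)
    have "net e = (\<Sum>v \<in> ?RV \<inter> {a, b}. \<phi> e v)"
      unfolding net_def using fl e ab fin
      by (intro sum.mono_neutral_right) (auto simp: unit_flow_def)
    moreover have "?RV \<inter> {a, b} = (if a \<in> R then {a} else {}) \<union> (if b \<in> R then {b} else {})"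
      using ab by auto
    moreover have "\<phi> e a = - \<phi> e b" using fl e ab by (auto simp: unit_flow_def)
    moreover have "ends G e = {b, a}" using ab by auto
    ultimately show ?thesis
      using ab e c[of e a b] c'[of e a b] c[of e b a] c'[of e b a]
      by (cases "a \<in> R"; cases "b \<in> R") (auto simp: mem_cut)
  qed
  \<comment> \<open>Conservation at the vertices of \<open>R\<close>, of which only \<open>s\<close>
    has a non-zero balance; afterwards the sums are exchanged.\<close>
  have "int k = (\<Sum>v \<in> ?RV. if v = s then int k else 0)" using R fin by simp
  also have "\<dots> = (\<Sum>v \<in> ?RV. \<Sum>e \<in> edges G. \<phi> e v)"
    using fl R by (intro sum.cong) (auto simp: unit_flow_def)
  also have "\<dots> = (\<Sum>e \<in> edges G. net e)"
    unfolding net_def by (rule sum.swap)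
  also have "\<dots> = (\<Sum>e \<in> cut G R. net e)"
    using net finite_edges cut_subset[of G R] by (intro sum.mono_neutral_right) auto
  finally have k: "int k = (\<Sum>e \<in> cut G R. net e)" .
  have "e \<in> cut G R \<Longrightarrow> c' \<le> net e \<and> net e \<le> c" for e
    using net cut_subset[of G R] by blast
  then show "int k \<le> c * int (card (cut G R))" "c' * int (card (cut G R)) \<le> int k"
    unfolding k using sum_bounded_above[of "cut G R" net c] sum_bounded_below[of "cut G R" c' net]
    by (auto simp: mult.commute)
qed

text \<open>Ford and Fulkerson: a step from \<open>a\<close> along \<open>e\<close> has residual
  capacity iff \<open>\<phi> e a \<le> 0\<close>. If \<open>t\<close> cannot be reached by such
  steps, every edge that leaves \<open>R\<close> carries a full unit outwards, so this cut has at
  most \<open>k\<close> edges.\<close>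

lemma unit_flow_augment:
  assumes fl: "unit_flow G s t k \<phi>" and s: "s \<in> vertices G"
    and cuts: "\<And>S. s \<in> S \<Longrightarrow> t \<notin> S \<Longrightarrow> k < card (cut G S)"
  shows "\<exists>\<psi>. unit_flow G s t (Suc k) \<psi>"
  using path_or_closed[OF s, of t "\<lambda>a e b. \<phi> e a \<le> 0"]
proof (elim disjE exE conjE)
  fix vs es
  assume p: "is_path G (vs, es)" and st: "hd vs = s" "last vs = t"
    and A: "\<forall>i < length es. \<phi> (es ! i) (vs ! i) \<le> 0"
  define \<psi> where "\<psi> e v = \<phi> e v + path_flow vs es e v" for e v
  have bound: "\<bar>\<psi> e a\<bar> \<le> 1" if e: "e \<in> edges G" and ab: "ends G e = {a, b}" for e a b
  proof (cases "e \<in> set es")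
    case True
    then obtain i where i: "i < length es" "e = es ! i" by (auto simp: in_set_conv_nth)
    then have "{a, b} = {vs ! i, vs ! Suc i}" "vs ! i \<noteq> vs ! Suc i"
      using p ab by (auto simp: is_path_def nth_eq_iff_index_eq)
    moreover have "\<phi> e a = - \<phi> e b" using fl e ab by (auto simp: unit_flow_def)
    moreover have "\<bar>\<phi> e a\<bar> \<le> 1" using fl e ab by (rule unit_flow_bound)
    moreover have "\<phi> e (vs ! i) \<le> 0" using A i by auto
    ultimately show ?thesis
      using i path_flow_nth[OF p i(1)] by (auto simp: \<psi>_def doubleton_eq_iff)
  next
    case False
    then show ?thesis using unit_flow_bound[OF fl e ab] by (simp add: \<psi>_def path_flow_outside)
  qed
  have "(\<Sum>e \<in> edges G. \<psi> e v) = int (Suc k) * (of_bool (v = s) - of_bool (v = t))"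
    if "v \<in> vertices G" for v
  proof -
    have "(\<Sum>e \<in> edges G. \<phi> e v) = int k * (of_bool (v = s) - of_bool (v = t))"
      using fl that by (simp add: unit_flow_def)
    then show ?thesis
      by (simp add: \<psi>_def sum.distrib path_flow_net[OF p] st algebra_simps)
  qed
  then have "unit_flow G s t (Suc k) \<psi>"
    using fl bound path_flow_ends[OF p]
    by (simp add: unit_flow_def) (simp add: \<psi>_def)
  then show ?thesis by blast
next
  fix R
  assume R: "s \<in> R" "t \<notin> R"
    and cl: "\<forall>e \<in> edges G. \<forall>a \<in> R. \<forall>b. b \<notin> R \<and> ends G e = {a, b} \<longrightarrow> \<not> \<phi> e a \<le> 0"
  have "1 * int (card (cut G R)) \<le> int k"
  proof (rule flow_across_cut(2)[OF fl R s, of 1 1])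
    show "\<phi> e a \<le> 1" if "e \<in> edges G" "ends G e = {a, b}" for e a b
      using unit_flow_bound[OF fl that] by simp
    show "1 \<le> \<phi> e a" if "e \<in> edges G" "ends G e = {a, b}" "a \<in> R" "b \<notin> R" for e a b
    proof -
      have "\<not> \<phi> e a \<le> 0" using cl[rule_format, of e a b] that by simp
      then show ?thesis by linarith
    qed
  qed
  then show ?thesis using cuts[OF R] by simp
qed

lemma unit_flow_exists:
  assumes s: "s \<in> vertices G"
    and cuts: "\<And>S. s \<in> S \<Longrightarrow> t \<notin> S \<Longrightarrow> k \<le> card (cut G S)"
  shows "\<exists>\<phi>. unit_flow G s t k \<phi>"
  using cuts
proof (induction k)
  case 0
  have "unit_flow G s t 0 (\<lambda>e v. 0)" by (simp add: unit_flow_def)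
  then show ?case by blast
next
  case (Suc k)
  then obtain \<phi> where "unit_flow G s t k \<phi>" by (meson Suc_leD)
  then show ?case using unit_flow_augment s Suc.prems by (metis Suc_le_eq)
qed

text \<open>A path of edges with flow 1 is split off and the rest decomposed by induction. The
  clause on the support of \<phi> makes the induction work: the remaining flow vanishes on the
  removed path, so the other paths avoid its edges.\<close>

lemma unit_flow_decompose:
  assumes s: "s \<in> vertices G" and "s \<noteq> t" and "unit_flow G s t k \<phi>"
  shows "\<exists>P. finite P \<and> card P = k \<and> edge_disjoint P \<and>
           (\<forall>p \<in> P. path_between G s t p \<and> (\<forall>e \<in> set (snd p). \<exists>v. \<phi> e v \<noteq> 0))"
  using assms(3)
proof (induction k arbitrary: \<phi>)
  case 0
  show ?case by (rule exI[of _ "{}"]) (simp add: edge_disjoint_def)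
next
  case (Suc k)
  note fl = Suc.prems
  from path_or_closed[OF s, of t "\<lambda>a e b. \<phi> e a = 1"] show ?case
  proof (elim disjE exE conjE)
    fix vs es
    assume p: "is_path G (vs, es)" and st: "hd vs = s" "last vs = t"
      and A: "\<forall>i < length es. \<phi> (es ! i) (vs ! i) = 1"
    define \<psi> where "\<psi> e v = \<phi> e v - path_flow vs es e v" for e v
    have zero: "\<psi> e v = 0" if e_es: "e \<in> set es" for e v
    proof -
      obtain i where i: "i < length es" "e = es ! i" using e_es by (auto simp: in_set_conv_nth)
      have "e \<in> edges G" "ends G e = {vs ! i, vs ! Suc i}"
        using p i by (auto simp: is_path_def)
      then have "\<phi> e (vs ! i) = - \<phi> e (vs ! Suc i)" "v \<notin> {vs ! i, vs ! Suc i} \<Longrightarrow> \<phi> e v = 0"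
        using fl by (auto simp: unit_flow_def)
      then show ?thesis using A i path_flow_nth[OF p i(1)] by (auto simp: \<psi>_def)
    qed
    have same: "\<psi> e v = \<phi> e v" if "e \<notin> set es" for e v
      using that by (simp add: \<psi>_def path_flow_outside)
    have bound: "\<bar>\<psi> e a\<bar> \<le> 1" if "e \<in> edges G" "ends G e = {a, b}" for e a b
      using unit_flow_bound[OF fl that] zero same by (cases "e \<in> set es") auto
    have "(\<Sum>e \<in> edges G. \<psi> e v) = int k * (of_bool (v = s) - of_bool (v = t))"
      if "v \<in> vertices G" for v
    proof -
      have "(\<Sum>e \<in> edges G. \<phi> e v) = int (Suc k) * (of_bool (v = s) - of_bool (v = t))"
        using fl that by (simp add: unit_flow_def)
      then show ?thesis
        by (simp add: \<psi>_def sum_subtractf path_flow_net[OF p] st algebra_simps)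
    qed
    then have "unit_flow G s t k \<psi>"
      using fl bound path_flow_ends[OF p]
      by (simp add: unit_flow_def) (simp add: \<psi>_def)
    from Suc.IH[OF this] obtain P where P: "finite P" "card P = k" "edge_disjoint P"
        and P': "\<forall>q \<in> P. path_between G s t q \<and> (\<forall>e \<in> set (snd q). \<exists>v. \<psi> e v \<noteq> 0)"
      by (elim exE conjE)
    have disj: "set (snd q) \<inter> set es = {}" if "q \<in> P" for q
      using P' that zero by (meson disjoint_iff)
    \<comment> \<open>A trivial path would be disjoint from itself; only a non-empty edge list
      guarantees that the number of paths grows.\<close>
    have "es \<noteq> []" using p st \<open>s \<noteq> t\<close> by (cases vs) (auto simp: is_path_def)
    then have new: "(vs, es) \<notin> P" using disj[of "(vs, es)"] by auto
    have supp: "\<exists>v. \<phi> e v \<noteq> 0" if "e \<in> set es" for e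
      using A that by (metis in_set_conv_nth zero_neq_one)
    have supp': "\<exists>v. \<phi> e v \<noteq> 0" if "q \<in> P" "e \<in> set (snd q)" for q e
      using P' disj[OF that(1)] that same by (metis disjoint_iff)
    show ?thesis
    proof (rule exI[of _ "insert (vs, es) P"], intro conjI ballI)
      show "finite (insert (vs, es) P)" "card (insert (vs, es) P) = Suc k"
        using P new by auto
      show "edge_disjoint (insert (vs, es) P)"
        using P(3) disj unfolding edge_disjoint_def by (metis Int_commute insert_iff snd_conv)
    next
      fix q assume q: "q \<in> insert (vs, es) P"
      show "path_between G s t q"
        using q P' p st by (auto simp: path_between_def)
      show "\<exists>v. \<phi> e v \<noteq> 0" if "e \<in> set (snd q)" for e
        using q supp supp' that by (metis insert_iff snd_conv)
    qed
  next
    fix R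
    assume R: "s \<in> R" "t \<notin> R"
      and cl: "\<forall>e \<in> edges G. \<forall>a \<in> R. \<forall>b. b \<notin> R \<and> ends G e = {a, b} \<longrightarrow> \<phi> e a \<noteq> 1"
    \<comment> \<open>If \<open>t\<close> cannot be reached along edges with flow 1, nothing flows
      out of \<open>R\<close>, although the value is positive.\<close>
    have "int (Suc k) \<le> 0 * int (card (cut G R))"
    proof (rule flow_across_cut(1)[OF fl R s, of 0 "-1"])
      show "\<phi> e a \<le> 0" if "e \<in> edges G" "ends G e = {a, b}" "a \<in> R" "b \<notin> R" for e a b
      proof -
        have "\<phi> e a \<noteq> 1" using cl[rule_format, of e a b] that by simp
        then show ?thesis using unit_flow_bound[OF fl that(1,2)] by linarith
      qed
      show "-1 \<le> \<phi> e a" if "e \<in> edges G" "ends G e = {a, b}" for e a b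
        using unit_flow_bound[OF fl that] by simp
    qed
    then show ?thesis by simp
  qed
qed

text \<open>Each path uses an edge of the cut, and disjoint paths use different ones.\<close>

lemma edge_disjoint_paths_le_cut:
  assumes P: "\<And>p. p \<in> P \<Longrightarrow> path_between G u v p" "edge_disjoint P" and S: "u \<in> S" "v \<notin> S"
  shows "card P \<le> card (cut G S)"
proof -
  have "\<exists>e. e \<in> set (snd p) \<inter> cut G S" if "p \<in> P" for p
  proof -
    have "is_path G (fst p, snd p)" and ends: "{hd (fst p), last (fst p)} = {u, v}"
      using P(1)[OF that] by (simp_all add: path_between_def)
    moreover have "(hd (fst p) \<in> S) \<noteq> (last (fst p) \<in> S)"
      using ends S unfolding doubleton_eq_iff by metis
    ultimately show ?thesis using path_crosses_cut by (meson ex_in_conv)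
  qed
  then obtain f where f: "\<And>p. p \<in> P \<Longrightarrow> f p \<in> set (snd p) \<inter> cut G S" by metis
  have "inj_on f P"
  proof (rule inj_onI, rule ccontr)
    fix p q assume "p \<in> P" "q \<in> P" "f p = f q" "p \<noteq> q"
    then have "set (snd p) \<inter> set (snd q) = {}" using P(2) by (simp add: edge_disjoint_def)
    then show False using f[OF \<open>p \<in> P\<close>] f[OF \<open>q \<in> P\<close>] \<open>f p = f q\<close> by auto
  qed
  then show ?thesis using f finite_cut by (intro card_inj_on_le[of f]) auto
qed

text \<open>Paths are bounded by every cut; conversely, large cuts admit a flow of value
  \<open>k\<close>, which decomposes into \<open>k\<close> paths. The form with a lower bound
  \<open>k\<close> lets connectivities be compared cut by cut.\<close>

theorem menger:
  assumes uv: "u \<in> vertices G" "u \<noteq> v"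
  shows "k \<le> local_edge_conn G u v \<longleftrightarrow> (\<forall>S. u \<in> S \<and> v \<notin> S \<longrightarrow> k \<le> card (cut G S))"
proof -
  let ?C = "{card P | P. finite P \<and> (\<forall>p \<in> P. path_between G u v p) \<and> edge_disjoint P}"
  have bound: "m \<le> card (cut G S)" if m: "m \<in> ?C" and S: "u \<in> S" "v \<notin> S" for m S
  proof -
    obtain P where "m = card P" "\<forall>p \<in> P. path_between G u v p" "edge_disjoint P"
      using m by (elim CollectE exE conjE)
    then show ?thesis using edge_disjoint_paths_le_cut[of P u v S] S by simp
  qed
  \<comment> \<open>\<open>Max\<close> has its intended meaning only on a finite non-empty set; the
    cut around \<open>u\<close> bounds the number of paths.\<close>
  have "?C \<subseteq> {..card (cut G {u})}" using bound uv by blast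
  then have fin: "finite ?C" by (rule finite_subset) simp
  have ne: "?C \<noteq> {}" by (auto intro!: exI[of _ "{}"] simp: edge_disjoint_def)
  have mem: "local_edge_conn G u v \<in> ?C"
    unfolding local_edge_conn_def using fin ne by (rule Max_in)
  show ?thesis
  proof
    assume "k \<le> local_edge_conn G u v"
    then show "\<forall>S. u \<in> S \<and> v \<notin> S \<longrightarrow> k \<le> card (cut G S)"
      using bound[OF mem] by (meson le_trans)
  next
    assume "\<forall>S. u \<in> S \<and> v \<notin> S \<longrightarrow> k \<le> card (cut G S)"
    then obtain \<phi> where "unit_flow G u v k \<phi>" using unit_flow_exists[OF uv(1)] by meson
    from unit_flow_decompose[OF uv this] obtain P
      where "finite P" "card P = k" "edge_disjoint P" "\<forall>p \<in> P. path_between G u v p"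
      by metis
    then have "k \<in> ?C" by blast
    then show "k \<le> local_edge_conn G u v"
      unfolding local_edge_conn_def using fin by (rule Max_ge[rotated])
  qed
qed

end

subsection \<open>Edge-connectivity and cuts\<close>

definition splits :: "('v, 'e) mgraph \<Rightarrow> 'v set \<Rightarrow> bool" where
  "splits G S \<longleftrightarrow> vertices G \<inter> S \<noteq> {} \<and> \<not> vertices G \<subseteq> S"

lemma splitsI: "u \<in> vertices G \<Longrightarrow> v \<in> vertices G \<Longrightarrow> u \<in> S \<Longrightarrow> v \<notin> S \<Longrightarrow> splits G S"
  by (auto simp: splits_def)

context multigraph
begin

lemma splits_if_mem_cut: "e \<in> cut G S \<Longrightarrow> splits G S"
  using ends_subset by (auto simp: cut_def splits_def)

lemma connected_graph_iff:
  "connected_graph G \<longleftrightarrow> vertices G \<noteq> {} \<and> (\<forall>S. splits G S \<longrightarrow> cut G S \<noteq> {})"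
proof (intro iffI conjI allI impI)
  fix S assume conn: "connected_graph G" and "splits G S"
  then obtain u v where uv: "u \<in> vertices G" "v \<in> vertices G" "u \<in> S" "v \<notin> S"
    by (auto simp: splits_def)
  obtain p where p: "path_between G u v p"
    using conn uv unfolding connected_graph_def by meson
  then have "is_path G (fst p, snd p)" and ends: "{hd (fst p), last (fst p)} = {u, v}"
    by (simp_all add: path_between_def)
  moreover have "(hd (fst p) \<in> S) \<noteq> (last (fst p) \<in> S)"
    using ends uv unfolding doubleton_eq_iff by metis
  ultimately show "cut G S \<noteq> {}" using path_crosses_cut by (metis inf_bot_right)
next
  assume cuts: "vertices G \<noteq> {} \<and> (\<forall>S. splits G S \<longrightarrow> cut G S \<noteq> {})"
  have "\<exists>p. path_between G u v p" if uv: "u \<in> vertices G" "v \<in> vertices G" for u v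
    using path_or_closed[OF uv(1), of v "\<lambda>_ _ _. True"]
  proof (elim disjE exE conjE)
    fix vs es assume "is_path G (vs, es)" "hd vs = u" "last vs = v"
    then have "path_between G u v (vs, es)" by (simp add: path_between_def)
    then show ?thesis by (rule exI)
  next
    fix R
    assume R: "u \<in> R" "v \<notin> R"
      and cl: "\<forall>e \<in> edges G. \<forall>a \<in> R. \<forall>b. b \<notin> R \<and> ends G e = {a, b} \<longrightarrow> \<not> True"
    obtain e where e: "e \<in> cut G R" using cuts uv R by (meson ex_in_conv splitsI)
    then have "e \<in> edges G" by (rule cut_edge)
    then obtain a b where ab: "ends G e = {a, b}" by (rule ends_cases)
    then have "(a \<in> R) \<noteq> (b \<in> R)" using e by (simp add: mem_cut)
    then show ?thesis
      using cl \<open>e \<in> edges G\<close> ab by (metis insert_commute)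
  qed
  then show "connected_graph G" using cuts by (simp add: connected_graph_def)
qed (simp add: connected_graph_def)

lemma multigraph_del_edges: "multigraph (del_edges G F)"
  using finite_vertices finite_edges ends_subset card_ends
  by unfold_locales (auto simp: del_edges_def)

end

lemma vertices_del_edges [simp]: "vertices (del_edges G F) = vertices G"
  by (simp add: del_edges_def)

lemma order_del_edges [simp]: "order (del_edges G F) = order G"
  by (simp add: order_def)

lemma splits_del_edges [simp]: "splits (del_edges G F) S \<longleftrightarrow> splits G S"
  by (simp add: splits_def)

lemma cut_del_edges [simp]: "cut (del_edges G F) S = cut G S - F"
  by (auto simp: cut_def del_edges_def)

context multigraph
begin

lemma connected_del_edges_iff:
  "connected_graph (del_edges G F) \<longleftrightarrow>
     vertices G \<noteq> {} \<and> (\<forall>S. splits G S \<longrightarrow> \<not> cut G S \<subseteq> F)"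
  using multigraph.connected_graph_iff[OF multigraph_del_edges] by simp

lemma edge_conn_le_cut:
  assumes "splits G S"
  shows "edge_conn G \<le> card (cut G S)"
  unfolding edge_conn_def
  by (rule Least_le, rule exI[of _ "cut G S"]) (use assms cut_subset[of G S] in
    \<open>auto simp: connected_del_edges_iff\<close>)

lemma edge_conn_attained:
  assumes "order G \<ge> 2"
  obtains S where "splits G S" "card (cut G S) = edge_conn G"
proof -
  \<comment> \<open>With two vertices some cut can be removed, so the \<open>LEAST\<close> in
    \<open>edge_conn\<close> ranges over a non-empty set.\<close>
  have "\<exists>u v. u \<in> vertices G \<and> v \<in> vertices G \<and> u \<noteq> v"
    using assms card_le_Suc0_iff_eq[OF finite_vertices] by (force simp: order_def)
  then obtain S where S: "splits G S" by (meson splitsI insertI1 singletonD)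
  have "\<exists>k F. F \<subseteq> edges G \<and> card F = k \<and> \<not> connected_graph (del_edges G F)"
    using S cut_subset[of G] by (auto simp: connected_del_edges_iff)
  then have "\<exists>F. F \<subseteq> edges G \<and> card F = edge_conn G \<and> \<not> connected_graph (del_edges G F)"
    unfolding edge_conn_def by (rule LeastI_ex)
  then obtain F where F: "F \<subseteq> edges G" "card F = edge_conn G" "\<not> connected_graph (del_edges G F)"
    by blast
  \<comment> \<open>A disconnecting set of edges contains a whole cut, and by minimality this cut
    has the same size.\<close>
  then obtain T where T: "splits G T" "cut G T \<subseteq> F"
    using S by (auto simp: connected_del_edges_iff splits_def)
  then have "card (cut G T) \<le> edge_conn G"
    using F(1,2) finite_edges by (metis card_mono finite_subset)
  then show ?thesis using edge_conn_le_cut[OF T(1)] T(1) that by simp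
qed

text \<open>Deleting an edge shrinks exactly the cuts that contain it, each by one. So a
  connectivity of 2 drops iff the edge lies in a cut of size 2.\<close>

lemma minimally_2_edge_connected_iff:
  "minimally_2_edge_connected G \<longleftrightarrow>
     order G \<ge> 2 \<and> (\<forall>S. splits G S \<longrightarrow> 2 \<le> card (cut G S)) \<and>
     (\<forall>e \<in> edges G. \<exists>S. e \<in> cut G S \<and> card (cut G S) = 2)"
proof (intro iffI conjI allI impI ballI)
  assume m: "minimally_2_edge_connected G"
  then show ord: "2 \<le> order G" by (simp add: minimally_2_edge_connected_def)
  show ge: "2 \<le> card (cut G S)" if "splits G S" for S
    using m edge_conn_le_cut[OF that] by (simp add: minimally_2_edge_connected_def)
  fix e assume "e \<in> edges G"
  then have lt: "edge_conn (del_edges G {e}) < 2"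
    using m by (simp add: minimally_2_edge_connected_def)
  obtain S where "splits G S" "card (cut G S - {e}) = edge_conn (del_edges G {e})"
    using multigraph.edge_conn_attained[OF multigraph_del_edges, of "{e}"] ord by auto
  then show "\<exists>S. e \<in> cut G S \<and> card (cut G S) = 2"
    using lt ge[of S] finite_cut[of S]
    by (intro exI[of _ S]) (cases "e \<in> cut G S"; simp)
next
  assume R: "order G \<ge> 2 \<and> (\<forall>S. splits G S \<longrightarrow> 2 \<le> card (cut G S)) \<and>
     (\<forall>e \<in> edges G. \<exists>S. e \<in> cut G S \<and> card (cut G S) = 2)"
  obtain S where S: "splits G S" "card (cut G S) = edge_conn G"
    using R edge_conn_attained by blast
  then have ge: "2 \<le> edge_conn G" using R by metis
  then obtain e where "e \<in> cut G S" using S(2) by (metis card.empty ex_in_conv not_numeral_le_zero)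
  then obtain T where "e \<in> cut G T" "card (cut G T) = 2" using R cut_edge by metis
  then have "edge_conn G = 2" using ge edge_conn_le_cut[of T] splits_if_mem_cut by force
  moreover have "edge_conn (del_edges G {e}) < 2" if "e \<in> edges G" for e
  proof -
    obtain T where "e \<in> cut G T" "card (cut G T) = 2" using R \<open>e \<in> edges G\<close> by blast
    then show ?thesis
      using multigraph.edge_conn_le_cut[OF multigraph_del_edges, of "{e}" T] splits_if_mem_cut
        finite_cut[of T] by simp
  qed
  ultimately show "minimally_2_edge_connected G"
    using R by (simp add: minimally_2_edge_connected_def)
qed

lemma local_edge_conn_le_cut:
  assumes "u \<in> vertices G" "u \<in> S" "v \<notin> S"
  shows "local_edge_conn G u v \<le> card (cut G S)"
  using menger[of u v "local_edge_conn G u v"] assms by auto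

lemma local_edge_conn_attained:
  assumes "u \<in> vertices G" "u \<noteq> v"
  obtains S where "u \<in> S" "v \<notin> S" "card (cut G S) = local_edge_conn G u v"
proof -
  have "\<not> Suc (local_edge_conn G u v) \<le> local_edge_conn G u v" by simp
  then obtain S where S: "u \<in> S" "v \<notin> S" "card (cut G S) < Suc (local_edge_conn G u v)"
    unfolding menger[OF assms] by (auto simp: not_le)
  then have "card (cut G S) = local_edge_conn G u v"
    using local_edge_conn_le_cut[OF assms(1) S(1,2)] by simp
  with S show ?thesis using that by blast
qed

text \<open>A set that separates \<open>a\<close> from \<open>c\<close> separates \<open>b\<close>
  from one of them. So having connectivity at least \<open>k\<close> divides the vertices into
  classes.\<close>

lemma local_edge_conn_trans:
  assumes "a \<in> vertices G" "b \<in> vertices G" "a \<noteq> c"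
    and "k \<le> local_edge_conn G a b" "k \<le> local_edge_conn G b c"
  shows "k \<le> local_edge_conn G a c"
  unfolding menger[OF assms(1,3)]
  using assms local_edge_conn_le_cut by (meson le_trans)

end

section \<open>Total connectivity in place of the average\<close>

definition vertex_pairs :: "('v, 'e) mgraph \<Rightarrow> 'v set set" where
  "vertex_pairs G = {S. S \<subseteq> vertices G \<and> card S = 2}"

definition total_edge_conn :: "('v, 'e) mgraph \<Rightarrow> nat" where
  "total_edge_conn G = (\<Sum>S \<in> vertex_pairs G. pair_edge_conn G S)"

lemma vertex_pairs_cases:
  assumes "S \<in> vertex_pairs G"
  obtains u v where "S = {u, v}" "u \<noteq> v" "u \<in> vertices G" "v \<in> vertices G"
  using assms by (auto simp: vertex_pairs_def card_2_iff)

lemma avg_edge_conn_eq: "avg_edge_conn G = real (total_edge_conn G) / real (order G choose 2)"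
  by (simp add: avg_edge_conn_def total_edge_conn_def vertex_pairs_def)

lemma avg_edge_conn_le_iff:
  assumes "order H = order G" "order G \<ge> 2"
  shows "avg_edge_conn H \<le> avg_edge_conn G \<longleftrightarrow> total_edge_conn H \<le> total_edge_conn G"
proof -
  have "order G choose 2 > 0" using assms(2) by simp
  then show ?thesis using assms(1) by (simp add: avg_edge_conn_eq divide_le_cancel)
qed

context multigraph
begin

lemma finite_vertex_pairs: "finite (vertex_pairs G)"
  using finite_vertices by (simp add: vertex_pairs_def)

lemma card_vertex_pairs: "card (vertex_pairs G) = order G choose 2"
  unfolding vertex_pairs_def order_def using finite_vertices by (rule n_subsets)

end

subsection \<open>Isomorphic copies\<close>

definition map_mgraph :: "('v \<Rightarrow> 'w) \<Rightarrow> ('e \<Rightarrow> 'f) \<Rightarrow> ('v, 'e) mgraph \<Rightarrow> ('w, 'f) mgraph" where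
  "map_mgraph f g G =
     \<lparr>vertices = f ` vertices G, edges = g ` edges G,
      ends = (\<lambda>e. f ` ends G (the_inv_into (edges G) g e))\<rparr>"

text \<open>Competitors live over the natural numbers, so a given graph is first copied there. The
  graphs constructed from the copy are then competitors themselves.\<close>

locale mgraph_iso = multigraph G for G :: "('v, 'e) mgraph" +
  fixes f :: "'v \<Rightarrow> 'w" and g :: "'e \<Rightarrow> 'f"
  assumes inj_f: "inj_on f (vertices G)" and inj_g: "inj_on g (edges G)"
begin

abbreviation "H \<equiv> map_mgraph f g G"

lemma vertices_map: "vertices H = f ` vertices G"
  and edges_map: "edges H = g ` edges G"
  by (simp_all add: map_mgraph_def)

lemma ends_map: "e \<in> edges G \<Longrightarrow> ends H (g e) = f ` ends G e"
  by (simp add: map_mgraph_def the_inv_into_f_f[OF inj_g])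

lemma order_map: "order H = order G"
  by (simp add: order_def vertices_map card_image inj_f)

lemma multigraph_map: "multigraph H"
proof
  show "finite (vertices H)" "finite (edges H)"
    using finite_vertices finite_edges by (simp_all add: vertices_map edges_map)
next
  fix e assume "e \<in> edges H"
  then obtain e' where e': "e = g e'" "e' \<in> edges G" by (auto simp: edges_map)
  then show "ends H e \<subseteq> vertices H"
    using ends_subset by (auto simp: ends_map vertices_map)
  show "card (ends H e) = 2"
    using e' ends_subset card_ends inj_on_subset[OF inj_f] by (simp add: ends_map card_image)
qed

lemma cut_map: "cut H S = g ` cut G (f -` S)"
proof -
  have "g e \<in> cut H S \<longleftrightarrow> e \<in> cut G (f -` S)" if "e \<in> edges G" for e
  proof -
    have "f ` ends G e \<inter> S = {} \<longleftrightarrow> ends G e \<inter> f -` S = {}" by auto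
    then show ?thesis
      using that by (simp add: cut_def edges_map ends_map image_subset_iff_subset_vimage)
  qed
  moreover have "cut H S \<subseteq> g ` edges G" using cut_subset[of H] by (simp add: edges_map)
  ultimately show ?thesis using cut_subset[of G] by blast
qed

lemma card_cut_map: "card (cut H S) = card (cut G (f -` S))"
  unfolding cut_map using inj_on_subset[OF inj_g cut_subset] by (rule card_image)

text \<open>\<open>f\<close> is injective on the vertices only, so \<open>S\<close> is restricted to
  them before its image is taken. Pulling the image back gives the same set of vertices, and hence
  the same cut.\<close>

lemma card_cut_map_image: "card (cut H (f ` (S \<inter> vertices G))) = card (cut G S)"
proof -
  have "f -` f ` (S \<inter> vertices G) \<inter> vertices G = S \<inter> vertices G"
    using inj_f by (auto simp: inj_on_def)
  then have "cut G (f -` f ` (S \<inter> vertices G)) = cut G S"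
    using cut_Int_vertices[of "f -` f ` (S \<inter> vertices G)"] cut_Int_vertices[of S] by simp
  then show ?thesis by (simp only: card_cut_map)
qed

lemma mem_image_iff: "v \<in> vertices G \<Longrightarrow> f v \<in> f ` (S \<inter> vertices G) \<longleftrightarrow> v \<in> S"
  using inj_f by (auto simp: inj_on_def)

lemma local_edge_conn_map:
  assumes "u \<in> vertices G" "v \<in> vertices G" "u \<noteq> v"
  shows "local_edge_conn H (f u) (f v) = local_edge_conn G u v"
proof -
  interpret H: multigraph H by (rule multigraph_map)
  have fuv: "f u \<in> vertices H" "f u \<noteq> f v"
    using assms inj_f by (auto simp: vertices_map inj_on_def)
  have "k \<le> local_edge_conn H (f u) (f v) \<longleftrightarrow> k \<le> local_edge_conn G u v" for k
    unfolding menger[OF assms(1,3)] H.menger[OF fuv]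
  proof (intro iffI allI impI)
    fix S assume *: "\<forall>S. f u \<in> S \<and> f v \<notin> S \<longrightarrow> k \<le> card (cut H S)" and "u \<in> S \<and> v \<notin> S"
    then show "k \<le> card (cut G S)"
      using *[rule_format, of "f ` (S \<inter> vertices G)"] assms
      by (simp add: mem_image_iff card_cut_map_image del: image_Int)
  next
    fix S assume *: "\<forall>S. u \<in> S \<and> v \<notin> S \<longrightarrow> k \<le> card (cut G S)" and "f u \<in> S \<and> f v \<notin> S"
    then show "k \<le> card (cut H S)"
      using *[rule_format, of "f -` S"] by (simp add: card_cut_map)
  qed
  then show ?thesis by (meson order_antisym order_refl)
qed

lemma total_edge_conn_map: "total_edge_conn H = total_edge_conn G"
proof -
  have "vertex_pairs H = (`) f ` vertex_pairs G"
  proof (intro equalityI subsetI)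
    fix S assume "S \<in> vertex_pairs H"
    then obtain a b where "S = {f a, f b}" "a \<noteq> b" "a \<in> vertices G" "b \<in> vertices G"
      by (elim vertex_pairs_cases) (auto simp: vertices_map)
    then have "S = f ` {a, b}" "{a, b} \<in> vertex_pairs G" by (auto simp: vertex_pairs_def)
    then show "S \<in> (`) f ` vertex_pairs G" by blast
  next
    fix S assume "S \<in> (`) f ` vertex_pairs G"
    then obtain T where T: "S = f ` T" "T \<subseteq> vertices G" "card T = 2"
      by (auto simp: vertex_pairs_def)
    then have "card (f ` T) = 2" using inj_on_subset[OF inj_f] by (simp add: card_image)
    then show "S \<in> vertex_pairs H" using T by (auto simp: vertex_pairs_def vertices_map)
  qed
  moreover have "inj_on ((`) f) (vertex_pairs G)"
    using inj_on_image_Pow[OF inj_f] by (rule inj_on_subset) (auto simp: vertex_pairs_def)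
  ultimately have "total_edge_conn H = (\<Sum>S \<in> vertex_pairs G. pair_edge_conn H (f ` S))"
    by (simp add: total_edge_conn_def sum.reindex)
  also have "\<dots> = total_edge_conn G"
    unfolding total_edge_conn_def
    by (intro sum.cong) (auto elim!: vertex_pairs_cases simp: pair_edge_conn_eq local_edge_conn_map)
  finally show ?thesis .
qed

lemma minimally_2_edge_connected_map:
  assumes "minimally_2_edge_connected G"
  shows "minimally_2_edge_connected H"
proof -
  interpret H: multigraph H by (rule multigraph_map)
  have m: "order G \<ge> 2" "\<And>S. splits G S \<Longrightarrow> 2 \<le> card (cut G S)"
    "\<And>e. e \<in> edges G \<Longrightarrow> \<exists>S. e \<in> cut G S \<and> card (cut G S) = 2"
    using assms unfolding minimally_2_edge_connected_iff by auto
  have "2 \<le> card (cut H S)" if "splits H S" for S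
  proof -
    have "splits G (f -` S)" using that by (auto simp: splits_def vertices_map)
    then show ?thesis unfolding card_cut_map by (rule m)
  qed
  moreover have "\<exists>S. e \<in> cut H S \<and> card (cut H S) = 2" if "e \<in> edges H" for e
  proof -
    obtain e' where e': "e = g e'" "e' \<in> edges G" using \<open>e \<in> edges H\<close> by (auto simp: edges_map)
    then obtain S where S: "e' \<in> cut G S" "card (cut G S) = 2" using m by blast
    have "f -` f ` (S \<inter> vertices G) \<inter> vertices G = S \<inter> vertices G"
      using inj_f by (auto simp: inj_on_def)
    then have "cut G (f -` f ` (S \<inter> vertices G)) = cut G S"
      using cut_Int_vertices[of "f -` f ` (S \<inter> vertices G)"] cut_Int_vertices[of S] by simp
    then have "e \<in> cut H (f ` (S \<inter> vertices G))" using S e' by (simp add: cut_map)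
    then show ?thesis using S card_cut_map_image by metis
  qed
  ultimately show ?thesis
    using m(1) by (simp add: H.minimally_2_edge_connected_iff order_map)
qed

end

subsection \<open>A graph with a pair of connectivity at least 3\<close>

text \<open>The edge of \<open>K\<^bsub>2,n-2\<^esub>\<close> that joins \<open>i \<ge> 2\<close> to \<open>j < 2\<close> is encoded as \<open>2 * i + j\<close>.\<close>

definition biclique2 :: "nat \<Rightarrow> (nat, nat) mgraph" where
  "biclique2 n = \<lparr>vertices = {..<n}, edges = {4..<2 * n}, ends = (\<lambda>e. {e div 2, e mod 2})\<rparr>"

lemma multigraph_biclique2: "multigraph (biclique2 n)"
proof
  fix e assume "e \<in> edges (biclique2 n)"
  then have e: "4 \<le> e" "e < 2 * n" by (simp_all add: biclique2_def)
  then have "e div 2 < n" "2 \<le> e div 2" "e mod 2 < 2" by auto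
  then show "ends (biclique2 n) e \<subseteq> vertices (biclique2 n)" "card (ends (biclique2 n) e) = 2"
    by (auto simp: biclique2_def)
qed (simp_all add: biclique2_def)

lemma order_biclique2: "order (biclique2 n) = n"
  by (simp add: order_def biclique2_def)

lemma mem_cut_biclique2:
  assumes "2 \<le> i" "i < n" "j < 2"
  shows "2 * i + j \<in> cut (biclique2 n) S \<longleftrightarrow> (i \<in> S) \<noteq> (j \<in> S)"
proof -
  have "(2 * i + j) div 2 = i" "(2 * i + j) mod 2 = j" using assms(3) by presburger+
  moreover have "4 \<le> 2 * i + j" "2 * i + j < 2 * n" using assms by linarith+
  ultimately have "ends (biclique2 n) (2 * i + j) = {i, j}" "2 * i + j \<in> edges (biclique2 n)"
    by (simp_all add: biclique2_def)
  then show ?thesis by (simp add: mem_cut)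
qed

lemma cut_biclique2_separating:
  assumes "(0 \<in> S) \<noteq> (1 \<in> S)"
  shows "n - 2 \<le> card (cut (biclique2 n) S)"
proof -
  interpret multigraph "biclique2 n" by (rule multigraph_biclique2)
  \<comment> \<open>The two neighbours 0 and 1 of \<open>i\<close> lie on different sides, so one of
    the two edges at \<open>i\<close> crosses.\<close>
  let ?h = "\<lambda>i. if (i \<in> S) \<noteq> (0 \<in> S) then 2 * i else 2 * i + 1"
  have "inj_on ?h {2..<n}" by (auto simp: inj_on_def split: if_splits)
  moreover have "?h ` {2..<n} \<subseteq> cut (biclique2 n) S"
    using assms mem_cut_biclique2[of _ n 0 S] mem_cut_biclique2[of _ n 1 S] by auto
  ultimately have "card {2..<n} \<le> card (cut (biclique2 n) S)"
    using card_inj_on_le finite_cut by blast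
  then show ?thesis by simp
qed

lemma minimally_2_edge_connected_biclique2:
  assumes "n \<ge> 4"
  shows "minimally_2_edge_connected (biclique2 n)"
proof -
  interpret multigraph "biclique2 n" by (rule multigraph_biclique2)
  have two: "2 \<le> card (cut (biclique2 n) S)"
    if "i \<in> {2..<n}" "(i \<in> S) \<noteq> (0 \<in> S)" "(0 \<in> S) = (1 \<in> S)" for S i
  proof -
    have "{2 * i, 2 * i + 1} \<subseteq> cut (biclique2 n) S"
      using that mem_cut_biclique2[of i n 0 S] mem_cut_biclique2[of i n 1 S] by auto
    from card_mono[OF finite_cut this] show ?thesis by simp
  qed
  have "2 \<le> card (cut (biclique2 n) S)" if "splits (biclique2 n) S" for S
  proof (cases "(0 \<in> S) = (1 \<in> S)")
    case True
    obtain a b where ab: "a < n" "b < n" "a \<in> S" "b \<notin> S"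
      using \<open>splits (biclique2 n) S\<close> by (auto simp: splits_def biclique2_def)
    \<comment> \<open>A vertex opposite to both 0 and 1; both of its edges cross.\<close>
    define i where "i = (if (0 \<in> S) then b else a)"
    have "(i \<in> S) \<noteq> (0 \<in> S)" "i < n" using ab by (auto simp: i_def)
    moreover from this True have "i \<noteq> 0" "i \<noteq> 1" by metis+
    ultimately show ?thesis using two[of i S] True by simp
  next
    case False
    then show ?thesis using cut_biclique2_separating[of S n] assms by simp
  qed
  moreover have "\<exists>S. e \<in> cut (biclique2 n) S \<and> card (cut (biclique2 n) S) = 2"
    if "e \<in> edges (biclique2 n)" for e
  proof -
    let ?i = "e div 2"
    have e: "4 \<le> e" "e < 2 * n" using \<open>e \<in> edges (biclique2 n)\<close> by (simp_all add: biclique2_def)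
    then have "2 \<le> ?i" "?i < n" by auto
    then have "x \<in> cut (biclique2 n) {?i} \<longleftrightarrow> x \<in> {2 * ?i, 2 * ?i + 1}" for x
      unfolding cut_singleton by (auto simp: biclique2_def)
    then have "cut (biclique2 n) {?i} = {2 * ?i, 2 * ?i + 1}" by blast
    moreover have "e \<in> {2 * ?i, 2 * ?i + 1}" by auto
    ultimately show ?thesis by (intro exI[of _ "{?i}"]) simp
  qed
  ultimately show ?thesis
    using assms unfolding minimally_2_edge_connected_iff by (simp add: order_biclique2)
qed

text \<open>Every pair contributes at least 2, and the vertices 0 and 1 have connectivity at least
  \<open>n - 2\<close>, which exceeds 2 from \<open>n = 5\<close> on.\<close>

lemma total_edge_conn_biclique2:
  assumes "n \<ge> 5"
  shows "2 * (n choose 2) < total_edge_conn (biclique2 n)"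
proof -
  interpret multigraph "biclique2 n" by (rule multigraph_biclique2)
  have m: "2 \<le> card (cut (biclique2 n) S)" if "splits (biclique2 n) S" for S
    using minimally_2_edge_connected_biclique2[of n] assms that
    unfolding minimally_2_edge_connected_iff by simp
  have "2 * (n choose 2) = (\<Sum>S \<in> vertex_pairs (biclique2 n). 2)"
    by (simp add: card_vertex_pairs order_biclique2)
  also have "\<dots> < total_edge_conn (biclique2 n)"
    unfolding total_edge_conn_def
  proof (rule sum_strict_mono_ex1[OF finite_vertex_pairs], intro ballI)
    fix S assume "S \<in> vertex_pairs (biclique2 n)"
    then obtain u v where uv: "S = {u, v}" "u \<noteq> v" "u \<in> vertices (biclique2 n)"
        "v \<in> vertices (biclique2 n)"
      by (rule vertex_pairs_cases)
    have "\<forall>T. u \<in> T \<and> v \<notin> T \<longrightarrow> 2 \<le> card (cut (biclique2 n) T)"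
      using m splitsI[OF uv(3,4)] by blast
    then show "2 \<le> pair_edge_conn (biclique2 n) S"
      using uv by (simp add: pair_edge_conn_eq menger)
  next
    have "3 \<le> local_edge_conn (biclique2 n) 0 1"
    proof (subst menger)
      show "\<forall>S. 0 \<in> S \<and> 1 \<notin> S \<longrightarrow> 3 \<le> card (cut (biclique2 n) S)"
        using cut_biclique2_separating[of _ n] assms by fastforce
    qed (use assms in \<open>simp_all add: biclique2_def\<close>)
    moreover have "{0, 1} \<in> vertex_pairs (biclique2 n)"
      using assms by (simp add: vertex_pairs_def biclique2_def)
    ultimately show "\<exists>S \<in> vertex_pairs (biclique2 n). 2 < pair_edge_conn (biclique2 n) S"
      by (intro bexI[of _ "{0, 1}"]) (simp_all add: pair_edge_conn_eq)
  qed
  finally show ?thesis .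
qed

subsection \<open>Minimally 2-edge-connected graphs\<close>

text \<open>An edge counted once on the left is counted on the right, and an edge counted twice on
  the left joins \<open>A \<inter> B\<close> to the outside of \<open>A \<union> B\<close> and is
  counted twice on the right.\<close>

lemma (in multigraph) card_cut_submodular:
  "card (cut G (A \<inter> B)) + card (cut G (A \<union> B)) \<le> card (cut G A) + card (cut G B)"
proof -
  have "e \<in> cut G (A \<inter> B) \<union> cut G (A \<union> B) \<longrightarrow> e \<in> cut G A \<union> cut G B"
    "e \<in> cut G (A \<inter> B) \<inter> cut G (A \<union> B) \<longrightarrow> e \<in> cut G A \<inter> cut G B" if "e \<in> edges G" for e
    using that by (rule ends_cases, auto simp: mem_cut)+
  then have "cut G (A \<inter> B) \<union> cut G (A \<union> B) \<subseteq> cut G A \<union> cut G B"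
    "cut G (A \<inter> B) \<inter> cut G (A \<union> B) \<subseteq> cut G A \<inter> cut G B"
    using cut_edge[of _ G] by blast+
  then have "card (cut G (A \<inter> B) \<union> cut G (A \<union> B)) \<le> card (cut G A \<union> cut G B)"
    "card (cut G (A \<inter> B) \<inter> cut G (A \<union> B)) \<le> card (cut G A \<inter> cut G B)"
    using finite_cut by (auto intro!: card_mono)
  then show ?thesis
    using card_Un_Int[OF finite_cut finite_cut, of A B]
      card_Un_Int[OF finite_cut finite_cut, of "A \<inter> B" "A \<union> B"] by linarith
qed

definition lonely :: "('v, 'e) mgraph \<Rightarrow> 'v \<Rightarrow> bool" where
  "lonely G u \<longleftrightarrow> (\<forall>v \<in> vertices G. v \<noteq> u \<longrightarrow> local_edge_conn G u v \<le> 2)"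

locale min2_graph = multigraph +
  assumes minimal: "minimally_2_edge_connected G"
begin

lemma order_ge_2: "2 \<le> order G"
  and cut_ge_2: "splits G S \<Longrightarrow> 2 \<le> card (cut G S)"
  and ex_2_cut: "e \<in> edges G \<Longrightarrow> \<exists>S. e \<in> cut G S \<and> card (cut G S) = 2"
  using minimal unfolding minimally_2_edge_connected_iff by auto

lemma local_edge_conn_ge_2:
  assumes "u \<in> vertices G" "v \<in> vertices G" "u \<noteq> v"
  shows "2 \<le> local_edge_conn G u v"
  unfolding menger[OF assms(1,3)] using cut_ge_2 splitsI[OF assms(1,2)] by blast

lemma two_cut_mate:
  assumes "card (cut G S) = 2" "e \<in> cut G S"
  obtains f where "f \<noteq> e" "cut G S = {e, f}"
proof -
  obtain a b where "cut G S = {a, b}" "a \<noteq> b" using assms(1) by (auto simp: card_2_iff)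
  with assms(2) show ?thesis using that[of a] that[of b] by auto
qed

lemma edge_mate:
  assumes "e \<in> edges G"
  obtains T f where "f \<noteq> e" "cut G T = {e, f}"
  using ex_2_cut[OF assms] two_cut_mate by metis

text \<open>The 2-cut through an edge separates the ends of that edge.\<close>

lemma local_edge_conn_adjacent:
  assumes "e \<in> edges G" "ends G e = {u, v}"
  shows "local_edge_conn G u v \<le> 2"
proof -
  obtain S where S: "e \<in> cut G S" "card (cut G S) = 2" using ex_2_cut[OF assms(1)] by blast
  then have "(u \<in> S) \<noteq> (v \<in> S)" using assms by (simp add: mem_cut)
  moreover have "u \<in> vertices G" using ends_subset[OF assms(1)] assms(2) by simp
  ultimately show ?thesis
    using local_edge_conn_le_cut[of u S v] local_edge_conn_le_cut[of u "- S" v] S(2)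
    by (cases "u \<in> S") (auto simp: cut_Compl)
qed

text \<open>Forming a 2-cut together is transitive: the common edge cancels.\<close>

lemma cut_sym_diff_mates:
  assumes "cut G S = {e, f}" "cut G T = {e, g}" "f \<noteq> e" "g \<noteq> e" "f \<noteq> g"
  shows "cut G (sym_diff S T) = {f, g}"
  unfolding cut_sym_diff assms(1,2) using assms(3-5) by blast

end

subsection \<open>Reattaching a vertex\<close>

text \<open>
  The edge \<open>e = uv\<close> is contracted into \<open>v\<close>, and \<open>u\<close> is put back as a new vertex with neighbours \<open>x\<close>
  and \<open>y\<close>, the edges \<open>e\<close> and \<open>z\<close> being reused.  This covers the subdivision of an edge \<open>z\<close> of \<open>G / e\<close>
  with ends \<open>x\<close> and \<open>y\<close> as well as the insertion of a new path \<open>x u y\<close>, for which \<open>z\<close> is either a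
  new edge or parallel to \<open>e\<close>.
\<close>

locale reattach = min2_graph G for G :: "('v, 'e) mgraph" +
  fixes u v :: 'v and e z :: 'e and x y :: 'v
  assumes e: "e \<in> edges G" "ends G e = {u, v}"
    and z: "z \<noteq> e"
    and parallel: "\<And>g. g \<in> edges G \<Longrightarrow> ends G g = {u, v} \<Longrightarrow> g = e \<or> g = z"
    and xy: "x \<in> vertices G" "x \<noteq> u" "y \<in> vertices G" "y \<noteq> u"
    and z_separates: "\<And>T. (u \<in> T) = (v \<in> T) \<Longrightarrow> z \<in> cut G T \<Longrightarrow> (x \<in> T) \<noteq> (y \<in> T)"
    and remaining_2_cut: "\<And>g. g \<in> edges G \<Longrightarrow> g \<noteq> e \<Longrightarrow> g \<noteq> z \<Longrightarrow>
      \<exists>T. card (cut G T) = 2 \<and> g \<in> cut G T \<and> e \<notin> cut G T \<and> ((x \<in> T) \<noteq> (y \<in> T) \<longrightarrow> z \<in> cut G T)"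
begin

text \<open>The contraction of \<open>e\<close>. A preimage under \<open>r\<close> has
  \<open>u\<close> and \<open>v\<close> on the same side, so its cut in \<open>G\<close> is a cut of
  the contracted graph.\<close>

definition r :: "'v \<Rightarrow> 'v" where
  "r w = (if w = u then v else w)"

text \<open>Since \<open>u\<close> itself is reused as the new vertex, \<open>G\<close> and
  \<open>G'\<close> have the same pairs of vertices and their totals can be compared term by
  term.\<close>

definition G' :: "('v, 'e) mgraph" where
  "G' = \<lparr>vertices = vertices G, edges = insert z (edges G),
     ends = (\<lambda>g. if g = e then {u, x} else if g = z then {u, y} else r ` ends G g)\<rparr>"

lemma u_v: "u \<in> vertices G" "v \<in> vertices G" "u \<noteq> v"
  using ends_subset[OF e(1)] card_ends[OF e(1)] e(2) by auto

lemma vertices_G' [simp]: "vertices G' = vertices G"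
  by (simp add: G'_def)

lemma order_G': "order G' = order G"
  by (simp add: order_def)

lemma ends_G': "g \<noteq> e \<Longrightarrow> g \<noteq> z \<Longrightarrow> ends G' g = r ` ends G g"
  by (simp add: G'_def)

lemma multigraph_G': "multigraph G'"
proof
  show "finite (vertices G')" "finite (edges G')"
    using finite_vertices finite_edges by (simp_all add: G'_def)
next
  fix g assume g: "g \<in> edges G'"
  show "ends G' g \<subseteq> vertices G'" "card (ends G' g) = 2"
  proof -
    consider "g = e" | "g = z" "g \<noteq> e" | "g \<in> edges G" "g \<noteq> e" "g \<noteq> z"
      using g by (auto simp: G'_def)
    then have "ends G' g \<subseteq> vertices G' \<and> card (ends G' g) = 2"
    proof cases
      case 3
      then obtain a b where ab: "ends G g = {a, b}" "a \<noteq> b" "a \<in> vertices G" "b \<in> vertices G"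
        using ends_cases by metis
      have "{a, b} \<noteq> {u, v}" using parallel[OF 3(1)] 3(2,3) ab(1) by metis
      then have "r a \<noteq> r b" using ab(2) by (auto simp: r_def doubleton_eq_iff split: if_splits)
      moreover have "r a \<in> vertices G" "r b \<in> vertices G" using ab u_v by (simp_all add: r_def)
      moreover have "ends G' g = {r a, r b}" using 3 ab(1) by (simp add: ends_G')
      ultimately show ?thesis by simp
    qed (use xy u_v in \<open>auto simp: G'_def\<close>)
    then show "ends G' g \<subseteq> vertices G'" "card (ends G' g) = 2" by auto
  qed
qed

interpretation G': multigraph G'
  by (rule multigraph_G')

lemma e_notin_cut: "e \<notin> cut G (r -` S)"
  using e u_v by (simp add: mem_cut r_def)

lemma cut_G':
  "cut G' S = (cut G (r -` S) - {z}) \<union> (if (u \<in> S) \<noteq> (x \<in> S) then {e} else {}) \<union>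
     (if (u \<in> S) \<noteq> (y \<in> S) then {z} else {})"
proof -
  have "g \<in> cut G' S \<longleftrightarrow> g \<in> cut G (r -` S)" if "g \<noteq> e" "g \<noteq> z" for g
  proof -
    have "r ` ends G g \<inter> S = {} \<longleftrightarrow> ends G g \<inter> r -` S = {}" by auto
    then show ?thesis
      using that by (simp add: cut_def G'_def image_subset_iff_subset_vimage)
  qed
  moreover have "e \<in> cut G' S \<longleftrightarrow> (u \<in> S) \<noteq> (x \<in> S)"
    using e by (auto simp: cut_def G'_def)
  moreover have "z \<in> cut G' S \<longleftrightarrow> (u \<in> S) \<noteq> (y \<in> S)"
    using z by (auto simp: cut_def G'_def)
  ultimately have "g \<in> cut G' S \<longleftrightarrow> g \<in> (cut G (r -` S) - {z}) \<union>
      (if (u \<in> S) \<noteq> (x \<in> S) then {e} else {}) \<union> (if (u \<in> S) \<noteq> (y \<in> S) then {z} else {})" for g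
    using e_notin_cut[of S] z by (cases "g = e"; cases "g = z") auto
  then show ?thesis by blast
qed

text \<open>Only \<open>z\<close> can be lost from the contracted cut. In that case \<open>x\<close>
  and \<open>y\<close> are separated, and exactly one of the two edges at \<open>u\<close> crosses
  in its place.\<close>

lemma card_cut_G'_ge: "card (cut G (r -` S)) \<le> card (cut G' S)"
proof (cases "z \<in> cut G (r -` S)")
  case True
  moreover have "(u \<in> r -` S) = (v \<in> r -` S)" using u_v by (simp add: r_def)
  ultimately have "(x \<in> r -` S) \<noteq> (y \<in> r -` S)" using z_separates by blast
  then have "(x \<in> S) \<noteq> (y \<in> S)" using xy by (simp add: r_def)
  then obtain h where h: "h \<in> {e, z}" "cut G' S = insert h (cut G (r -` S) - {z})"
    by (cases "u \<in> S"; cases "x \<in> S") (auto simp: cut_G')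
  then have "h \<notin> cut G (r -` S) - {z}" using e_notin_cut by auto
  then show ?thesis using h True finite_cut card_Suc_Diff1[of "cut G (r -` S)" z] by simp
next
  case False
  then have "cut G (r -` S) \<subseteq> cut G' S" by (auto simp: cut_G')
  then show ?thesis using G'.finite_cut by (rule card_mono[rotated])
qed

lemma cut_G'_ge_2:
  assumes "splits G' S"
  shows "2 \<le> card (cut G' S)"
proof (cases "splits G (r -` S)")
  case True
  then show ?thesis using cut_ge_2 card_cut_G'_ge le_trans by blast
next
  \<comment> \<open>Here all vertices other than \<open>u\<close> lie on one side, so
    \<open>u\<close> is cut off and both of its edges cross.\<close>
  case False
  have same: "a \<in> r -` S \<longleftrightarrow> b \<in> r -` S" if "a \<in> vertices G" "b \<in> vertices G" for a b
    using False that splitsI by metis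
  have "w \<in> S \<longleftrightarrow> v \<in> S" if "w \<in> vertices G" "w \<noteq> u" for w
    using same[OF that(1) u_v(2)] that(2) u_v(3) by (simp add: r_def)
  moreover from this have "(u \<in> S) \<noteq> (v \<in> S)"
    using assms unfolding splits_def vertices_G' by blast
  ultimately have "{e, z} \<subseteq> cut G' S" using xy by (auto simp: cut_G')
  from card_mono[OF G'.finite_cut this] show ?thesis using z by simp
qed

lemma ex_2_cut_G':
  assumes "g \<in> edges G'"
  shows "\<exists>S. g \<in> cut G' S \<and> card (cut G' S) = 2"
proof (cases "g = e \<or> g = z")
  case True
  have "r -` {u} = {}" using u_v by (auto simp: r_def split: if_splits)
  then have "cut G' {u} = {e, z}" using xy unfolding cut_G' by (auto simp: cut_def)
  then show ?thesis using True z by (intro exI[of _ "{u}"]) auto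
next
  case False
  then have "g \<in> edges G" using assms by (simp add: G'_def)
  then obtain T where T: "card (cut G T) = 2" "g \<in> cut G T" "e \<notin> cut G T"
      "(x \<in> T) \<noteq> (y \<in> T) \<longrightarrow> z \<in> cut G T"
    using remaining_2_cut False by blast
  have uv: "(u \<in> T) = (v \<in> T)" using T(3) e by (simp add: mem_cut)
  \<comment> \<open>\<open>T\<close> does not separate \<open>u\<close> from \<open>v\<close>, so
    \<open>u\<close> may be moved to the side of \<open>x\<close>. Then \<open>e\<close> does not
    cross, and \<open>z\<close> crosses iff \<open>y\<close> lies on the other side.\<close>
  define S where "S = (if x \<in> T then insert u T else T - {u})"
  have "r -` S = T" using uv u_v(3) by (auto simp: S_def r_def split: if_splits)
  moreover have "(u \<in> S) = (x \<in> S)" using xy by (simp add: S_def)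
  moreover have "(u \<in> S) \<noteq> (y \<in> S) \<longleftrightarrow> z \<in> cut G T"
    using z_separates[OF uv] T(4) xy by (auto simp: S_def)
  ultimately have "cut G' S = cut G T" by (auto simp: cut_G')
  then show ?thesis using T by auto
qed

lemma min2_graph_G': "min2_graph G'"
proof
  show "minimally_2_edge_connected G'"
    unfolding G'.minimally_2_edge_connected_iff
    using order_ge_2 cut_G'_ge_2 ex_2_cut_G' by (simp add: order_G')
qed

interpretation G': min2_graph G'
  by (rule min2_graph_G')

section \<open>Connectivities after the reattachment\<close>

lemma local_edge_conn_G'_ge:
  assumes "a \<in> vertices G" "b \<in> vertices G" "a \<noteq> b" "b \<noteq> u" "r a \<noteq> b"
  shows "local_edge_conn G a b \<le> local_edge_conn G' (r a) b"
proof -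
  have ra: "r a \<in> vertices G'" using assms(1) u_v by (simp add: r_def)
  show ?thesis
    unfolding G'.menger[OF ra assms(5)]
  proof (intro allI impI)
    fix S assume "r a \<in> S \<and> b \<notin> S"
    then have "local_edge_conn G a b \<le> card (cut G (r -` S))"
      using assms by (intro local_edge_conn_le_cut) (simp_all add: r_def)
    then show "local_edge_conn G a b \<le> card (cut G' S)" using card_cut_G'_ge le_trans by blast
  qed
qed

lemma local_edge_conn_G'_other:
  assumes "a \<in> vertices G" "b \<in> vertices G" "a \<noteq> b" "a \<noteq> u" "b \<noteq> u"
  shows "local_edge_conn G a b \<le> local_edge_conn G' a b"
  using local_edge_conn_G'_ge[of a b] assms by (simp add: r_def)

lemma local_edge_conn_G'_merged:
  assumes "b \<in> vertices G" "b \<noteq> u" "b \<noteq> v"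
  shows "local_edge_conn G u b \<le> local_edge_conn G' v b"
  using local_edge_conn_G'_ge[of u b] assms u_v by (simp add: r_def)

text \<open>\<open>z\<close> is absent from the contracted cuts, so the path through
  \<open>u\<close> adds an edge to every cut that separates \<open>x\<close> from
  \<open>y\<close>.\<close>

lemma local_edge_conn_G'_new:
  assumes "x \<noteq> y" and "\<And>T. (u \<in> T) = (v \<in> T) \<Longrightarrow> z \<notin> cut G T"
  shows "local_edge_conn G x y < local_edge_conn G' x y"
proof -
  have x: "x \<in> vertices G'" using xy by simp
  have "Suc (local_edge_conn G x y) \<le> local_edge_conn G' x y"
    unfolding G'.menger[OF x assms(1)]
  proof (intro allI impI)
    fix S assume S: "x \<in> S \<and> y \<notin> S"
    have z': "z \<notin> cut G (r -` S)" using u_v by (intro assms(2)) (simp add: r_def)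
    obtain h where h: "h \<in> {e, z}" "cut G' S = insert h (cut G (r -` S))"
      using S z' by (cases "u \<in> S") (auto simp: cut_G')
    then have "h \<notin> cut G (r -` S)" using e_notin_cut z' by auto
    moreover have "local_edge_conn G x y \<le> card (cut G (r -` S))"
      using S xy by (intro local_edge_conn_le_cut) (simp_all add: r_def)
    ultimately show "Suc (local_edge_conn G x y) \<le> card (cut G' S)"
      using h finite_cut by simp
  qed
  then show ?thesis by simp
qed

text \<open>A pair that contains \<open>u\<close> had connectivity at most 2, which every pair has
  in \<open>G'\<close>; all other pairs survive the contraction.\<close>

lemma local_edge_conn_G'_lonely:
  assumes "lonely G u" "a \<in> vertices G" "b \<in> vertices G" "a \<noteq> b"
  shows "local_edge_conn G a b \<le> local_edge_conn G' a b"
proof (cases "a = u \<or> b = u")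
  case True
  then have "local_edge_conn G a b \<le> 2"
    using assms local_edge_conn_commute[of G a b] by (auto simp: lonely_def)
  also have "2 \<le> local_edge_conn G' a b"
    using assms by (intro G'.local_edge_conn_ge_2) simp_all
  finally show ?thesis .
qed (use assms local_edge_conn_G'_other in auto)

lemma total_edge_conn_G'_ge:
  assumes "lonely G u"
  shows "total_edge_conn G \<le> total_edge_conn G'"
proof -
  have "vertex_pairs G' = vertex_pairs G" by (simp add: vertex_pairs_def)
  then show ?thesis
    unfolding total_edge_conn_def using local_edge_conn_G'_lonely[OF assms]
    by (auto intro!: sum_mono elim!: vertex_pairs_cases simp: pair_edge_conn_eq)
qed

lemma total_edge_conn_G'_gt:
  assumes "lonely G u" and "x \<noteq> y" and "\<And>T. (u \<in> T) = (v \<in> T) \<Longrightarrow> z \<notin> cut G T"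
  shows "total_edge_conn G < total_edge_conn G'"
proof -
  have "vertex_pairs G' = vertex_pairs G" by (simp add: vertex_pairs_def)
  moreover have "(\<Sum>S \<in> vertex_pairs G. pair_edge_conn G S) <
      (\<Sum>S \<in> vertex_pairs G. pair_edge_conn G' S)"
  proof (rule sum_strict_mono_ex1[OF finite_vertex_pairs], intro ballI)
    show "pair_edge_conn G S \<le> pair_edge_conn G' S" if "S \<in> vertex_pairs G" for S
      using that local_edge_conn_G'_lonely[OF assms(1)]
      by (elim vertex_pairs_cases) (simp add: pair_edge_conn_eq)
    have "{x, y} \<in> vertex_pairs G" using xy assms(2) by (simp add: vertex_pairs_def)
    then show "\<exists>S \<in> vertex_pairs G. pair_edge_conn G S < pair_edge_conn G' S"
      using local_edge_conn_G'_new[OF assms(2,3)]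
      by (intro bexI[of _ "{x, y}"]) (simp_all add: pair_edge_conn_eq)
  qed
  ultimately show ?thesis by (simp add: total_edge_conn_def)
qed

text \<open>
  Of the connectivities of \<open>u\<close> and \<open>v\<close> to another vertex, one is 2 and the other one survives
  at \<open>v\<close>.  The sum is therefore compared along the involution that exchanges \<open>u\<close> and \<open>v\<close> in the pairs
  in which the larger value occurs at \<open>u\<close>.
\<close>

lemma total_edge_conn_G'_gt_strong:
  assumes a: "a \<in> vertices G" "a \<noteq> u" "3 \<le> local_edge_conn G u a"
    and b: "b \<in> vertices G" "b \<noteq> v" "3 \<le> local_edge_conn G v b"
  shows "total_edge_conn G < total_edge_conn G'"
proof -
  define A where "A = {w \<in> vertices G - {u, v}. 3 \<le> local_edge_conn G u w}"
  define swap where "swap w = (if w = u then v else if w = v then u else w)" for w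
  define \<pi> where "\<pi> S = (if S \<inter> A \<noteq> {} \<and> S \<inter> {u, v} \<noteq> {} then swap ` S else S)" for S
  have uv: "local_edge_conn G u v \<le> 2" using local_edge_conn_adjacent e by blast
  \<comment> \<open>Otherwise transitivity through \<open>w\<close> would give the adjacent vertices
    \<open>u\<close> and \<open>v\<close> connectivity at least 3.\<close>
  have v_A: "local_edge_conn G v w \<le> 2" if "w \<in> A" for w
  proof (rule ccontr)
    assume "\<not> ?thesis"
    then have "3 \<le> local_edge_conn G w v" by (simp add: local_edge_conn_commute)
    then have "3 \<le> local_edge_conn G u v"
      using that u_v by (intro local_edge_conn_trans[of u w v]) (auto simp: A_def)
    then show False using uv by simp
  qed
  have swap_swap: "swap (swap w) = w" for w by (simp add: swap_def)
  have swap_V: "swap w \<in> vertices G" if "w \<in> vertices G" for w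
    using that u_v by (simp add: swap_def)
  have swap_A: "swap w \<in> A \<longleftrightarrow> w \<in> A" "swap w \<in> {u, v} \<longleftrightarrow> w \<in> {u, v}" for w
    by (auto simp: swap_def A_def)
  have swap_card: "card (swap ` S) = card S" for S
    by (rule card_image) (metis inj_onI swap_swap)
  have swap_image: "swap ` swap ` S = S" for S by (simp add: image_image swap_swap)
  have swap_cond: "swap ` S \<inter> A \<noteq> {} \<longleftrightarrow> S \<inter> A \<noteq> {}"
    "swap ` S \<inter> {u, v} \<noteq> {} \<longleftrightarrow> S \<inter> {u, v} \<noteq> {}" for S
    using swap_A by blast+
  have \<pi>_\<pi>: "\<pi> (\<pi> S) = S" for S
    unfolding \<pi>_def by (simp only: swap_cond swap_image if_cancel split: if_splits) simp
  have \<pi>_pairs: "\<pi> S \<in> vertex_pairs G" if "S \<in> vertex_pairs G" for S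
    using that swap_V by (auto simp: \<pi>_def vertex_pairs_def swap_card)
  have le: "pair_edge_conn G S \<le> pair_edge_conn G' (\<pi> S)" if S: "S \<in> vertex_pairs G" for S
  proof -
    have ge2: "2 \<le> pair_edge_conn G' T" if "T \<in> vertex_pairs G" for T
      using that by (elim vertex_pairs_cases)
        (auto simp: pair_edge_conn_eq intro!: G'.local_edge_conn_ge_2)
    obtain c d where cd: "S = {c, d}" "c \<noteq> d" "c \<in> vertices G" "d \<in> vertices G"
      using S by (rule vertex_pairs_cases)
    have main: ?thesis
      if S': "S = {c, d}" "c \<noteq> d" "c \<in> vertices G" "d \<in> vertices G" "d \<noteq> u" "d \<noteq> v" for c d
    proof (cases "local_edge_conn G c d \<le> 2")
      case True
      then show ?thesis
        using ge2[OF \<pi>_pairs[OF S]] S' by (simp add: pair_edge_conn_eq)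
    next
      case False
      consider "c = u" | "c = v" | "c \<noteq> u" "c \<noteq> v" by blast
      then show ?thesis
      proof cases
        case 1
        then have "d \<in> A" using S' False by (simp add: A_def)
        then have "\<pi> S = {v, d}" using S' 1 by (simp add: \<pi>_def swap_def insert_commute)
        then show ?thesis
          using local_edge_conn_G'_merged S' 1 by (simp add: pair_edge_conn_eq)
      next
        case 2
        then have "d \<notin> A" using False v_A by auto
        then have "\<pi> S = S" using S' 2 by (simp add: \<pi>_def A_def)
        then show ?thesis
          using local_edge_conn_G'_other[of v d] S' 2 u_v by (simp add: pair_edge_conn_eq)
      next
        case 3
        then have "\<pi> S = S" using S' by (simp add: \<pi>_def)
        then show ?thesis
          using local_edge_conn_G'_other[of c d] S' 3 by (simp add: pair_edge_conn_eq)
      qed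
    qed
    show ?thesis
    proof (cases "d \<in> {u, v}")
      case False
      then show ?thesis using main[of c d] cd by simp
    next
      case d: True
      show ?thesis
      proof (cases "c \<in> {u, v}")
        case False
        then show ?thesis using main[of d c] cd by (simp add: insert_commute)
      next
        case True
        then have "S = {u, v}" using d cd by auto
        then show ?thesis
          using ge2[OF \<pi>_pairs[OF S]] uv by (simp add: pair_edge_conn_eq)
      qed
    qed
  qed
  \<comment> \<open>The strict gain occurs at the pair of \<open>a\<close> and \<open>b\<close>.
    They lie in the different classes of \<open>u\<close> and \<open>v\<close> in \<open>G\<close>,
    but \<open>G'\<close> joins both of them to \<open>v\<close> with connectivity at least
    3.\<close>
  have av: "a \<noteq> v" using a(3) uv by auto
  have bu: "b \<noteq> u" using b(3) uv by (auto simp: local_edge_conn_commute)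
  have ab: "a \<noteq> b"
    using v_A[of a] a b av by (auto simp: A_def)
  have "local_edge_conn G a b \<le> 2"
  proof (rule ccontr)
    assume "\<not> ?thesis"
    then have "3 \<le> local_edge_conn G u b"
      using a b u_v bu by (intro local_edge_conn_trans[of u a b]) auto
    then have "b \<in> A" using b bu by (simp add: A_def)
    then show False using v_A b(3) by fastforce
  qed
  moreover have "3 \<le> local_edge_conn G' a b"
  proof (rule G'.local_edge_conn_trans[of a v b])
    show "3 \<le> local_edge_conn G' a v"
      using local_edge_conn_G'_merged[of a] a av by (simp add: local_edge_conn_commute)
    show "3 \<le> local_edge_conn G' v b"
      using local_edge_conn_G'_other[of v b] b bu u_v by simp
  qed (use a b ab u_v in simp_all)
  ultimately have strict: "pair_edge_conn G {a, b} < pair_edge_conn G' (\<pi> {a, b})"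
    using av bu a b by (simp add: \<pi>_def pair_edge_conn_eq)
  have "total_edge_conn G < (\<Sum>S \<in> vertex_pairs G. pair_edge_conn G' (\<pi> S))"
    unfolding total_edge_conn_def
  proof (rule sum_strict_mono_ex1[OF finite_vertex_pairs])
    show "\<exists>S \<in> vertex_pairs G. pair_edge_conn G S < pair_edge_conn G' (\<pi> S)"
      using strict a b ab by (intro bexI[of _ "{a, b}"]) (simp_all add: vertex_pairs_def)
  qed (use le in blast)
  also have "\<dots> = (\<Sum>S \<in> vertex_pairs G. pair_edge_conn G' S)"
    by (rule sum.reindex_bij_witness[of _ \<pi> \<pi>]) (simp_all add: \<pi>_\<pi> \<pi>_pairs)
  also have "\<dots> = total_edge_conn G'"
    by (simp add: total_edge_conn_def vertex_pairs_def)
  finally show ?thesis .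
qed

end

section \<open>2-cuts that survive a contraction\<close>

context min2_graph
begin

text \<open>If the 2-cut through \<open>g\<close> uses \<open>e\<close>, it is
  \<open>{e, g}\<close>, and its symmetric difference with \<open>T\<close> has the cut
  \<open>{f, g}\<close>. Thus edges other than \<open>e\<close> and \<open>f\<close> keep a 2-cut
  when \<open>e\<close> is contracted.\<close>

lemma two_cut_avoiding:
  assumes T: "cut G T = {e, f}" "f \<noteq> e" and g: "g \<in> edges G" "g \<noteq> e" "g \<noteq> f"
  obtains S where "card (cut G S) = 2" "g \<in> cut G S" "e \<notin> cut G S"
proof -
  obtain R where R: "g \<in> cut G R" "card (cut G R) = 2" using ex_2_cut[OF g(1)] by blast
  show ?thesis
  proof (cases "e \<in> cut G R")
    case True
    then obtain h where "h \<noteq> e" "cut G R = {e, h}" using R two_cut_mate by metis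
    then have "cut G R = {e, g}" using R(1) g(2) by auto
    then have "cut G (sym_diff T R) = {f, g}" using cut_sym_diff_mates T g by metis
    then show ?thesis using that[of "sym_diff T R"] T(2) g by simp
  next
    case False
    then show ?thesis using R that by blast
  qed
qed

lemma lonely_swap:
  "lonely G u \<Longrightarrow> v \<in> vertices G \<Longrightarrow> v \<noteq> u \<Longrightarrow> local_edge_conn G v u \<le> 2"
  by (simp add: lonely_def local_edge_conn_commute[of G v u])

lemma lonely_cut:
  assumes "lonely G u" "u \<in> vertices G" "w \<in> vertices G" "w \<noteq> u"
  obtains R where "u \<in> R" "w \<notin> R" "card (cut G R) = 2"
proof -
  obtain R where R: "u \<in> R" "w \<notin> R" "card (cut G R) = local_edge_conn G u w"
    using local_edge_conn_attained[of u w] assms by metis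
  moreover have "local_edge_conn G u w = 2"
    using local_edge_conn_ge_2[of u w] assms by (force simp: lonely_def)
  ultimately show ?thesis using that by simp
qed

lemma not_lonelyE:
  assumes "\<not> lonely G v"
  obtains b where "b \<in> vertices G" "b \<noteq> v" "3 \<le> local_edge_conn G v b"
  using assms by (auto simp: lonely_def not_le Suc_le_eq numeral_eq_Suc)

text \<open>For highly connected \<open>x\<close> and \<open>y\<close>, a new path between them
  leaves all old 2-cuts intact.\<close>

lemma cut_same_side:
  assumes "x \<in> vertices G" "y \<in> vertices G" "3 \<le> local_edge_conn G x y" "card (cut G T) = 2"
  shows "x \<in> T \<longleftrightarrow> y \<in> T"
proof (rule ccontr)
  assume "\<not> ?thesis"
  then have "local_edge_conn G x y \<le> card (cut G T)"
    using local_edge_conn_le_cut[of x T y] local_edge_conn_le_cut[of x "- T" y] assms(1)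
    by (cases "x \<in> T") (auto simp: cut_Compl)
  then show False using assms by simp
qed

text \<open>This instance subdivides the mate \<open>f\<close> of \<open>e\<close>. The ends of
  \<open>f\<close> are taken in the contracted graph, which is why \<open>v\<close> replaces
  \<open>u\<close>.\<close>

lemma reattach_mate:
  assumes e: "e \<in> edges G" "ends G e = {u, v}" and T: "cut G T = {e, f}" "f \<noteq> e"
    and f: "ends G f = {p, q}"
  shows "reattach G u v e f (if p = u then v else p) (if q = u then v else q)"
proof unfold_locales
  have uv: "u \<in> vertices G" "v \<in> vertices G" "u \<noteq> v"
    using ends_subset[OF e(1)] card_ends[OF e(1)] e(2) by auto
  have f_edge: "f \<in> edges G" using T(1) cut_edge[of f G T] by simp
  have pq: "p \<in> vertices G" "q \<in> vertices G" using ends_subset[OF f_edge] f by auto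
  show "e \<in> edges G" "ends G e = {u, v}" "f \<noteq> e" by fact+
  have "(u \<in> T) \<noteq> (v \<in> T)" using e T(1) mem_cut[OF e(2), of T] by simp
  then show "g = e \<or> g = f" if "g \<in> edges G" "ends G g = {u, v}" for g
    using that T(1) mem_cut[OF that(2), of T] by auto
  show "(if p = u then v else p) \<in> vertices G" "(if p = u then v else p) \<noteq> u"
    "(if q = u then v else q) \<in> vertices G" "(if q = u then v else q) \<noteq> u"
    using uv pq by auto
  have *: "f \<in> cut G S \<longleftrightarrow> ((if p = u then v else p) \<in> S) \<noteq> ((if q = u then v else q) \<in> S)"
    if "(u \<in> S) = (v \<in> S)" for S
    using that f_edge mem_cut[OF f, of S] by auto
  then show "((if p = u then v else p) \<in> S) \<noteq> ((if q = u then v else q) \<in> S)"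
    if "(u \<in> S) = (v \<in> S)" "f \<in> cut G S" for S
    using that by blast
  fix g assume g: "g \<in> edges G" "g \<noteq> e" "g \<noteq> f"
  obtain S where S: "card (cut G S) = 2" "g \<in> cut G S" "e \<notin> cut G S"
    using T g by (rule two_cut_avoiding)
  then have "(u \<in> S) = (v \<in> S)" using e mem_cut[OF e(2), of S] by simp
  then show "\<exists>S. card (cut G S) = 2 \<and> g \<in> cut G S \<and> e \<notin> cut G S \<and>
      (((if p = u then v else p) \<in> S) \<noteq> ((if q = u then v else q) \<in> S) \<longrightarrow> f \<in> cut G S)"
    using S * by blast
qed

end

subsection \<open>Optimal graphs\<close>

locale optimal_graph = min2_graph G for G :: "(nat, nat) mgraph" +
  assumes order_ge_5: "5 \<le> order G"
    and optimal: "\<And>H :: (nat, nat) mgraph.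
      min2_graph H \<Longrightarrow> order H = order G \<Longrightarrow> total_edge_conn H \<le> total_edge_conn G"
begin

lemma ex_not_lonely:
  obtains x y where "x \<in> vertices G" "y \<in> vertices G" "x \<noteq> y" "3 \<le> local_edge_conn G x y"
proof -
  have "\<exists>x y. x \<in> vertices G \<and> y \<in> vertices G \<and> x \<noteq> y \<and> 3 \<le> local_edge_conn G x y"
  proof (rule ccontr)
    assume neg: "\<not> ?thesis"
    have "pair_edge_conn G S \<le> 2" if S: "S \<in> vertex_pairs G" for S
    proof -
      obtain x y where "S = {x, y}" "x \<noteq> y" "x \<in> vertices G" "y \<in> vertices G"
        using S by (rule vertex_pairs_cases)
      moreover from this have "\<not> 3 \<le> local_edge_conn G x y" using neg by blast
      ultimately show ?thesis by (simp add: pair_edge_conn_eq)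
    qed
    then have "total_edge_conn G \<le> card (vertex_pairs G) * 2"
      unfolding total_edge_conn_def using sum_bounded_above[of "vertex_pairs G" "pair_edge_conn G" 2] by simp
    moreover have "min2_graph (biclique2 (order G))"
      using multigraph_biclique2 minimally_2_edge_connected_biclique2 order_ge_5
      by (simp add: min2_graph_def min2_graph_axioms_def)
    then have "total_edge_conn (biclique2 (order G)) \<le> total_edge_conn G"
      by (rule optimal) (rule order_biclique2)
    ultimately show False
      using total_edge_conn_biclique2[OF order_ge_5] by (simp add: card_vertex_pairs)
  qed
  then show ?thesis using that by blast
qed

text \<open>Otherwise contracting \<open>e\<close> and subdividing a mate of it would merge two
  classes and beat the optimum.\<close>

lemma edge_lonely:
  assumes e: "e \<in> edges G" "ends G e = {u, v}"
  shows "lonely G u \<or> lonely G v"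
proof (rule ccontr)
  assume neg: "\<not> ?thesis"
  obtain T f where T: "f \<noteq> e" "cut G T = {e, f}" using e(1) by (rule edge_mate)
  then have "f \<in> edges G" using cut_edge[of f G T] by simp
  then obtain p q where f: "ends G f = {p, q}" by (rule ends_cases)
  interpret R: reattach G u v e f "if p = u then v else p" "if q = u then v else q"
    using e T(2,1) f by (rule reattach_mate)
  obtain a where a: "a \<in> vertices G" "a \<noteq> u" "3 \<le> local_edge_conn G u a"
    using neg by (auto elim: not_lonelyE)
  obtain b where b: "b \<in> vertices G" "b \<noteq> v" "3 \<le> local_edge_conn G v b"
    using neg by (auto elim: not_lonelyE)
  have "total_edge_conn G < total_edge_conn R.G'"
    using a b by (rule R.total_edge_conn_G'_gt_strong)
  then show False using optimal[OF R.min2_graph_G' R.order_G'] by simp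
qed

text \<open>With two mates, every edge other than \<open>e\<close> lies in a 2-cut without
  \<open>e\<close>. So contracting \<open>e\<close> alone preserves minimality, and \<open>u\<close>
  can be inserted between two highly connected vertices at a strict gain.\<close>

lemma unique_mate:
  assumes u: "lonely G u" and e: "e \<in> edges G" "ends G e = {u, v}"
    and T: "cut G T = {e, f}" "f \<noteq> e" and R: "cut G R = {e, g}" "g \<noteq> e"
  shows "f = g"
proof (rule ccontr)
  assume fg: "f \<noteq> g"
  obtain x y where xy: "x \<in> vertices G" "y \<in> vertices G" "x \<noteq> y" "3 \<le> local_edge_conn G x y"
    by (rule ex_not_lonely)
  have xu: "x \<noteq> u" "y \<noteq> u"
    using xy u lonely_swap[OF u xy(1)] by (auto simp: lonely_def)
  \<comment> \<open>The new path needs one edge beyond \<open>e\<close>; a fresh name exists among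
    the natural numbers.\<close>
  obtain z where z: "z \<notin> edges G" using finite_edges infinite_UNIV_nat by (metis ex_new_if_finite)
  interpret R: reattach G u v e z x y
  proof unfold_locales
    show "e \<in> edges G" "ends G e = {u, v}" by fact+
    show "z \<noteq> e" using z e by auto
    \<comment> \<open>An edge parallel to \<open>e\<close> crosses both cuts, so it would have to be
      both \<open>f\<close> and \<open>g\<close>.\<close>
    have "(u \<in> T) \<noteq> (v \<in> T)" "(u \<in> R) \<noteq> (v \<in> R)"
      using e T(1) R(1) mem_cut[OF e(2), of T] mem_cut[OF e(2), of R] by auto
    then show "h = e \<or> h = z" if "h \<in> edges G" "ends G h = {u, v}" for h
      using that T(1) R(1) fg mem_cut[OF that(2), of T] mem_cut[OF that(2), of R] by auto
    show "x \<in> vertices G" "x \<noteq> u" "y \<in> vertices G" "y \<noteq> u" by fact+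
    show "(x \<in> S) \<noteq> (y \<in> S)" if "z \<in> cut G S" for S
      using that z cut_edge[of z G S] by simp
    fix h assume h: "h \<in> edges G" "h \<noteq> e" "h \<noteq> z"
    obtain S where "card (cut G S) = 2" "h \<in> cut G S" "e \<notin> cut G S"
    proof (cases "h = f")
      case False
      with T h(1,2) show ?thesis by (rule two_cut_avoiding) (rule that)
    next
      \<comment> \<open>For \<open>f\<close> itself the roles change: the other mate
        \<open>g\<close> and its cut \<open>R\<close> provide the 2-cut.\<close>
      case True
      with R h(1,2) fg show ?thesis by (metis two_cut_avoiding that)
    qed
    then show "\<exists>S. card (cut G S) = 2 \<and> h \<in> cut G S \<and> e \<notin> cut G S \<and>
        ((x \<in> S) \<noteq> (y \<in> S) \<longrightarrow> z \<in> cut G S)"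
      using cut_same_side[OF xy(1,2,4)] by blast
  qed
  have "total_edge_conn G < total_edge_conn R.G'"
    using u xy(3) by (rule R.total_edge_conn_G'_gt) (use z cut_edge[of z G] in blast)
  then show False using optimal[OF R.min2_graph_G' R.order_G'] by simp
qed

text \<open>If \<open>f\<close> missed \<open>u\<close>, its end \<open>p\<close> on the side of
  \<open>u\<close> could be separated from \<open>u\<close> by a 2-cut. Uncrossing that cut with
  \<open>T\<close> yields a 2-cut through \<open>e\<close> that avoids \<open>f\<close>, contrary to
  the uniqueness of the mate.\<close>

lemma mate_at_lonely_aux:
  assumes u: "lonely G u" and e: "e \<in> edges G" "ends G e = {u, v}"
    and T: "cut G T = {e, f}" "f \<noteq> e" and uT: "u \<in> T"
  shows "u \<in> ends G f"
proof (rule ccontr)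
  assume neg: "u \<notin> ends G f"
  have f: "f \<in> edges G" using T cut_edge[of f G T] by simp
  obtain p q where pq: "ends G f = {p, q}" "p \<in> T" "q \<notin> T" "p \<in> vertices G"
  proof -
    obtain a b where ab: "ends G f = {a, b}" "a \<in> vertices G" "b \<in> vertices G"
      using f by (rule ends_cases)
    have "(a \<in> T) \<noteq> (b \<in> T)" using T mem_cut[OF ab(1), of T] by simp
    then show ?thesis using that[of a b] that[of b a] ab by (auto simp: insert_commute)
  qed
  have vT: "v \<notin> T" using uT T mem_cut[OF e(2), of T] by simp
  have mates: "g = f" if "cut G S = {e, g}" "g \<noteq> e" for S g
    using unique_mate[OF u e T that] by simp
  have u_V: "u \<in> vertices G" using ends_subset[OF e(1)] e(2) by simp
  have "p \<noteq> u" using neg pq(1) by auto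
  with u u_V pq(4) obtain R where R: "u \<in> R" "p \<notin> R" "card (cut G R) = 2"
    by (rule lonely_cut)
  have eR: "e \<notin> cut G R"
  proof
    assume "e \<in> cut G R"
    \<comment> \<open>As \<open>f\<close> is the only mate, both cuts coincide and the symmetric
      difference has no crossing edge, yet it separates \<open>p\<close> from
      \<open>u\<close>.\<close>
    then have "cut G R = cut G T" using R(3) T(1) mates two_cut_mate by metis
    then have "cut G (sym_diff T R) = {}" unfolding cut_sym_diff by simp
    moreover have "splits G (sym_diff T R)"
      using splitsI[OF pq(4) u_V, of "sym_diff T R"] R(1,2) uT pq(2) by simp
    ultimately show False using cut_ge_2 by fastforce
  qed
  have fR: "f \<notin> cut G R"
  proof
    assume "f \<in> cut G R"
    then obtain g where g: "g \<noteq> f" "cut G R = {f, g}" using R(3) two_cut_mate by metis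
    have "g \<noteq> e" using eR g(2) by auto
    have "cut G T = {f, e}" using T(1) by auto
    then have "cut G (sym_diff T R) = {e, g}"
      using cut_sym_diff_mates[of T f e R g] g T(2) \<open>g \<noteq> e\<close> by simp
    then show False using mates g(1) \<open>g \<noteq> e\<close> by blast
  qed
  have "v \<in> R" using eR R(1) e mem_cut[OF e(2), of R] by simp
  have "q \<notin> R" using fR R(2) f mem_cut[OF pq(1), of R] by simp
  have q_V: "q \<in> vertices G" using ends_subset[OF f] pq(1) by simp
  \<comment> \<open>Both sets contain \<open>u\<close> and miss \<open>q\<close>, so submodularity
    forces their cuts to have exactly two edges.\<close>
  have "2 \<le> card (cut G (R \<inter> T))" "2 \<le> card (cut G (R \<union> T))"
    using R pq uT u_V q_V \<open>q \<notin> R\<close> splitsI[of u G q "R \<inter> T"] splitsI[of u G q "R \<union> T"]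
    by (auto intro: cut_ge_2)
  moreover have "card (cut G T) = 2" using T by simp
  ultimately have "card (cut G (R \<inter> T)) = 2" using card_cut_submodular[of R T] R(3) by simp
  moreover have "e \<in> cut G (R \<inter> T)" using e vT R(1) uT mem_cut[OF e(2), of "R \<inter> T"] by simp
  ultimately obtain g where "g \<noteq> e" "cut G (R \<inter> T) = {e, g}" using two_cut_mate by metis
  then have "f \<in> cut G (R \<inter> T)" using mates by auto
  then show False using R(2) pq(3) mem_cut[OF pq(1), of "R \<inter> T"] by simp
qed

lemma mate_at_lonely:
  assumes u: "lonely G u" and e: "e \<in> edges G" "ends G e = {u, v}"
    and T: "cut G T = {e, f}" "f \<noteq> e"
  shows "u \<in> ends G f"
proof (cases "u \<in> T")
  case False
  then show ?thesis using mate_at_lonely_aux[OF u e, of "- T" f] T by (simp add: cut_Compl)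
qed (use mate_at_lonely_aux assms in blast)

text \<open>The mate \<open>f\<close> meets both lonely ends, so it is parallel to \<open>e\<close>.
  Contracting \<open>e\<close> turns \<open>f\<close> into a loop, and both edges are free to form a
  new path through \<open>u\<close> between highly connected vertices.\<close>

lemma edge_not_both_lonely:
  assumes e: "e \<in> edges G" "ends G e = {u, v}" and u: "lonely G u" and v: "lonely G v"
  shows False
proof -
  obtain T f where T: "f \<noteq> e" "cut G T = {e, f}" using e(1) by (rule edge_mate)
  have f: "f \<in> edges G" using T cut_edge[of f G T] by simp
  have uv: "u \<noteq> v" using card_ends[OF e(1)] e(2) by auto
  have "ends G e = {v, u}" using e(2) by auto
  then have "u \<in> ends G f" "v \<in> ends G f"
    using mate_at_lonely[OF u e T(2,1)] mate_at_lonely[OF v e(1) _ T(2,1)] by simp_all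
  moreover obtain p q where "ends G f = {p, q}" using f by (rule ends_cases)
  ultimately have f_ends: "ends G f = {u, v}" using uv by auto
  obtain x y where xy: "x \<in> vertices G" "y \<in> vertices G" "x \<noteq> y" "3 \<le> local_edge_conn G x y"
    by (rule ex_not_lonely)
  have xu: "x \<noteq> u" "y \<noteq> u"
    using xy u lonely_swap[OF u xy(1)] by (auto simp: lonely_def)
  have f_cut: "f \<in> cut G S \<longleftrightarrow> e \<in> cut G S" for S
    using mem_cut[OF e(2), of S] mem_cut[OF f_ends, of S] e(1) f by simp
  have f_same: "f \<notin> cut G S" if "(u \<in> S) = (v \<in> S)" for S
    using that mem_cut[OF f_ends, of S] by simp
  interpret R: reattach G u v e f x y
  proof unfold_locales
    show "e \<in> edges G" "ends G e = {u, v}" "f \<noteq> e" by fact+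
    show "h = e \<or> h = f" if "h \<in> edges G" "ends G h = {u, v}" for h
      using that T(2) e mem_cut[OF that(2), of T] mem_cut[OF e(2), of T] by auto
    show "x \<in> vertices G" "x \<noteq> u" "y \<in> vertices G" "y \<noteq> u" by fact+
    show "(x \<in> S) \<noteq> (y \<in> S)" if "(u \<in> S) = (v \<in> S)" "f \<in> cut G S" for S
      using that f_same by blast
    fix h assume h: "h \<in> edges G" "h \<noteq> e" "h \<noteq> f"
    obtain S where "card (cut G S) = 2" "h \<in> cut G S" "e \<notin> cut G S"
      using T(2,1) h by (rule two_cut_avoiding)
    then show "\<exists>S. card (cut G S) = 2 \<and> h \<in> cut G S \<and> e \<notin> cut G S \<and>
        ((x \<in> S) \<noteq> (y \<in> S) \<longrightarrow> f \<in> cut G S)"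
      using cut_same_side[OF xy(1,2,4)] by blast
  qed
  have "total_edge_conn G < total_edge_conn R.G'"
    using u xy(3) f_same by (rule R.total_edge_conn_G'_gt)
  then show False using optimal[OF R.min2_graph_G' R.order_G'] by simp
qed

lemma card_cut_vertex_ge_2:
  assumes "v \<in> vertices G"
  shows "2 \<le> card (cut G {v})"
proof -
  have "vertices G \<noteq> {v}" using order_ge_2 by (auto simp: order_def)
  then show ?thesis using assms by (intro cut_ge_2) (auto simp: splits_def)
qed

text \<open>A third edge \<open>h\<close> at \<open>u\<close> besides \<open>e\<close> and its mate
  joins \<open>v\<close> to \<open>w\<close> after the reattachment. Neither end is lonely there,
  although the new graph is still optimal.\<close>

lemma lonely_degree:
  assumes u: "lonely G u" and u_V: "u \<in> vertices G"
  shows "card (cut G {u}) = 2"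
proof (rule ccontr)
  assume "\<not> ?thesis"
  then have deg: "3 \<le> card (cut G {u})" using card_cut_vertex_ge_2[OF u_V] by simp
  have incident: "\<exists>w. ends G h = {u, w}" if "h \<in> cut G {u}" for h
    using that card_ends[of h] unfolding cut_singleton card_2_iff by (auto simp: insert_commute)
  have "cut G {u} \<noteq> {}" using deg by (metis card.empty not_numeral_le_zero)
  then obtain e where e': "e \<in> cut G {u}" by blast
  then obtain v where e: "e \<in> edges G" "ends G e = {u, v}" using incident cut_edge by metis
  obtain T f where T: "f \<noteq> e" "cut G T = {e, f}" using e(1) by (rule edge_mate)
  have f: "f \<in> edges G" using T cut_edge[of f G T] by simp
  then obtain p q where f_ends: "ends G f = {p, q}" by (rule ends_cases)
  have "\<not> cut G {u} \<subseteq> {e, f}"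
  proof
    assume "cut G {u} \<subseteq> {e, f}"
    then have "card (cut G {u}) \<le> card {e, f}" by (intro card_mono) simp_all
    then show False using deg T(1) by simp
  qed
  then obtain h where h': "h \<in> cut G {u}" "h \<noteq> e" "h \<noteq> f" by blast
  then obtain w where h: "h \<in> edges G" "ends G h = {u, w}" using incident cut_edge by metis
  interpret R: reattach G u v e f "if p = u then v else p" "if q = u then v else q"
    using e T(2,1) f_ends by (rule reattach_mate)
  \<comment> \<open>The total does not drop at a lonely \<open>u\<close>, so
    \<open>edge_lonely\<close> applies to the new graph as well.\<close>
  have R_optimal: "optimal_graph R.G'"
  proof (intro optimal_graph.intro optimal_graph_axioms.intro)
    show "min2_graph R.G'" by (rule R.min2_graph_G')
    show "5 \<le> order R.G'" using order_ge_5 by (simp add: R.order_G')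
    show "total_edge_conn H \<le> total_edge_conn R.G'"
      if "min2_graph H" "order H = order R.G'" for H :: "(nat, nat) mgraph"
      using optimal[OF that(1)] that(2) R.total_edge_conn_G'_ge[OF u] by (simp add: R.order_G')
  qed
  \<comment> \<open>Neighbours of the lonely \<open>u\<close> are not lonely in \<open>G\<close>,
    and no connectivity decreases.\<close>
  have not_lonely: "\<not> lonely R.G' a" if g: "g \<in> edges G" "ends G g = {u, a}" for g a
  proof -
    have a: "a \<in> vertices G" "a \<noteq> u"
      using ends_subset[OF g(1)] card_ends[OF g(1)] g(2) by auto
    have "\<not> lonely G a" using edge_not_both_lonely[OF g u] by blast
    then obtain b where b: "b \<in> vertices G" "b \<noteq> a" "3 \<le> local_edge_conn G a b"
      by (rule not_lonelyE)
    have "3 \<le> local_edge_conn R.G' a b"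
      using R.local_edge_conn_G'_lonely[OF u a(1) b(1)] b by simp
    then show ?thesis using b unfolding lonely_def by force
  qed
  have "w \<noteq> u" using card_ends[OF h(1)] h(2) by auto
  then have "ends R.G' h = {v, w}" using h h' by (simp add: R.ends_G' R.r_def insert_commute)
  moreover have "h \<in> edges R.G'" using h(1) by (simp add: R.G'_def)
  ultimately have "lonely R.G' v \<or> lonely R.G' w"
    using optimal_graph.edge_lonely[OF R_optimal] by blast
  then show False using not_lonely e h by blast
qed

lemma edge_degrees:
  assumes "e \<in> edges G"
  shows "\<exists>a b. ends G e = {a, b} \<and> card (cut G {a}) = 2 \<and> 2 < card (cut G {b})"
proof -
  have *: ?thesis
    if e: "ends G e = {a, b}" "a \<in> vertices G" "b \<in> vertices G" and a: "lonely G a" for a b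
  proof -
    have "\<not> lonely G b" using edge_not_both_lonely[OF assms e(1) a] by blast
    then obtain c where c: "c \<in> vertices G" "c \<noteq> b" "3 \<le> local_edge_conn G b c"
      by (rule not_lonelyE)
    \<comment> \<open>The cut around \<open>b\<close> separates it from \<open>c\<close>, so the
      degree of \<open>b\<close> is at least their connectivity.\<close>
    have "local_edge_conn G b c \<le> card (cut G {b})"
      using c e by (intro local_edge_conn_le_cut) auto
    then have "2 < card (cut G {b})" using c(3) by simp
    with e(1) lonely_degree[OF a e(2)] show ?thesis by blast
  qed
  obtain a b where ab: "ends G e = {a, b}" "a \<in> vertices G" "b \<in> vertices G"
    using assms by (rule ends_cases)
  then have "ends G e = {b, a}" by auto
  then show ?thesis using edge_lonely[OF assms ab(1)] * ab by blast
qed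

end

section \<open>Transfer to arbitrary vertex and edge types\<close>

theorem corollary3p10:
  fixes G :: "('v, 'e) mgraph" and n :: nat
  assumes "multigraph G"
    and "order G = n" and "n \<ge> 5"
    and "edge_optimal G"
  shows "bipartite_with G {v \<in> vertices G. degree G v = 2} {v \<in> vertices G. degree G v > 2}"
proof -
  interpret multigraph G by fact
  have "minimally_2_edge_connected G" using assms(4) by (simp add: edge_optimal_def)
  then interpret min2_graph G by unfold_locales
  obtain f :: "'v \<Rightarrow> nat" where f: "inj_on f (vertices G)"
    using finite_imp_inj_to_nat_seg[OF finite_vertices] by blast
  obtain g :: "'e \<Rightarrow> nat" where g: "inj_on g (edges G)"
    using finite_imp_inj_to_nat_seg[OF finite_edges] by blast
  interpret I: mgraph_iso G f g by unfold_locales (fact f, fact g)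
  interpret H: optimal_graph "map_mgraph f g G"
  proof (intro optimal_graph.intro optimal_graph_axioms.intro min2_graph.intro
      min2_graph_axioms.intro)
    show "multigraph (map_mgraph f g G)" by (rule I.multigraph_map)
    show "minimally_2_edge_connected (map_mgraph f g G)"
      using minimal by (rule I.minimally_2_edge_connected_map)
    show "5 \<le> order (map_mgraph f g G)" using assms by (simp add: I.order_map)
    fix K :: "(nat, nat) mgraph"
    assume K: "min2_graph K" "order K = order (map_mgraph f g G)"
    then have "avg_edge_conn K \<le> avg_edge_conn G"
      using assms(4) unfolding edge_optimal_def
      by (simp add: I.order_map min2_graph_def min2_graph_axioms_def)
    then show "total_edge_conn K \<le> total_edge_conn (map_mgraph f g G)"
      using K(2) order_ge_2 avg_edge_conn_le_iff[of K G]
      by (simp add: I.total_edge_conn_map I.order_map)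
  qed
  have degree: "degree G v = card (cut G {v})" for v
    by (simp add: degree_def cut_singleton)
  have degree_map: "card (cut (map_mgraph f g G) {f v}) = degree G v" if "v \<in> vertices G" for v
    using I.card_cut_map_image[of "{v}"] that by (simp add: degree)
  \<comment> \<open>This makes the two degree classes cover all vertices.\<close>
  have "2 \<le> degree G v" if "v \<in> vertices G" for v
    using H.card_cut_vertex_ge_2[of "f v"] degree_map[OF that] that by (simp add: I.vertices_map)
  moreover have "\<exists>a \<in> {v \<in> vertices G. degree G v = 2}. \<exists>b \<in> {v \<in> vertices G. degree G v > 2}.
      ends G e = {a, b}" if e: "e \<in> edges G" for e
  proof -
    have "g e \<in> edges (map_mgraph f g G)" using e by (simp add: I.edges_map)
    then obtain a' b' where ab': "ends (map_mgraph f g G) (g e) = {a', b'}"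
        "card (cut (map_mgraph f g G) {a'}) = 2" "2 < card (cut (map_mgraph f g G) {b'})"
      using H.edge_degrees by blast
    obtain a b where ab: "ends G e = {a, b}" "a \<in> vertices G" "b \<in> vertices G"
      using e by (rule ends_cases)
    then have "{f a, f b} = {a', b'}" using ab'(1) e by (simp add: I.ends_map)
    then consider "a' = f a" "b' = f b" | "a' = f b" "b' = f a"
      by (auto simp: doubleton_eq_iff)
    then show ?thesis
    proof cases
      case 1
      then show ?thesis using ab ab'(2,3) by (auto simp: degree_map)
    next
      case 2
      then show ?thesis using ab ab'(2,3)
        by (intro bexI[of _ b] bexI[of _ a]) (auto simp: degree_map)
    qed
  qed
  ultimately show ?thesis
    unfolding bipartite_with_def by (auto simp: order_less_le)
qed

end
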